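(* Let $\tau\in\mathbb{C}$ with $\mathrm{Im}(\tau)>0$, $q=e^{2\pi i\tau}$, $\alpha\in\mathbb{C}$, $a=q^\alpha=e^{2\pi i\alpha\tau}$, and let $x,\lambda,\lambda'\in\mathbb{C}\setminus\{0\}$ be such that all terms below are defined (no denominator vanishes). With $f_0,f_\infty,g_\infty$ the solutions of the $q$-Hermite--Weber equation $[T_x^2-(1-xq)\sqrt a\,T_x-xq]f(x)=0$ given by $$f_0(x,\lambda)=x^{\frac\alpha2}\mathcal{L}^{+}\circ\mathcal{B}^{+}(\widetilde f_0)(x,\lambda),\quad f_\infty(x,\lambda)=f_0(x^{-1},\lambda),\quad g_0(x)=\frac{x^{1-\frac\alpha2}}{\theta_q(-x)}\,{}_1\phi_1\left(\begin{matrix} q/a \\ 0 \end{matrix};q,xq\right),\quad g_\infty(x)=g_0(x^{-1}),$$ where $\widetilde f_0(x)={}_2\phi_0\left(\begin{matrix} a,0 \\ - \end{matrix};q,\frac xa\right)$, one has $$f_0(x,\lambda')=\frac{\theta_q(\lambda')\theta_q(ax/\lambda')\,x^\alpha}{\theta_q(\lambda'/a)\theta_q(x/\lambda')\,a}\,f_\infty(x,\lambda)-(a)_\infty(q)_\infty^2\,\frac{\theta_q(-\lambda'/x\lambda)\,\theta_q(-x)\,\theta_q(-\lambda\lambda'/a)}{\theta_q(x\lambda)\,\theta_q(\lambda'/x)\,\theta_q(\lambda'/a)\,\theta_q(a/\lambda)}\,g_\infty(x).$$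
   Context: Powers: $q^s:=e^{2\pi is\tau}$, $\sqrt a=q^{\alpha/2}$; one branch of $\log x$ is fixed, $x^{\beta}=e^{\beta\log x}$ and $(x^{-1})^\beta=x^{-\beta}$. $T_xf(x)=f(qx)$. $(x)_\infty=(x;q)_\infty=\prod_{j\ge0}(1-xq^j)$, $(x)_n=(x)_\infty/(q^nx)_\infty$. $\theta_q(x)=(q)_\infty(-x)_\infty(-q/x)_\infty=\sum_{n\in\mathbb{Z}}x^nq^{n(n-1)/2}$. The expression $\lambda'/x\lambda$ means $\lambda'/(x\lambda)$. ${}_r\phi_s\left(\begin{matrix} a_1,\dots,a_r \\ b_1,\dots,b_s \end{matrix};q,x\right)=\sum_{n\ge0}\frac{(a_1)_n\cdots(a_r)_n}{(b_1)_n\cdots(b_s)_n(q)_n}\big((-1)^nq^{n(n-1)/2}\big)^{s-r+1}x^n$ (as a formal series for ${}_2\phi_0$), so $\widetilde f_0(x)=\sum_{n\ge0}\frac{(a)_n}{(q)_n}(-1)^nq^{-n(n-1)/2}(x/a)^n$ and ${}_1\phi_1\left(\begin{matrix} A \\ 0 \end{matrix};q,x\right)=\sum_{n\ge0}\frac{(A)_n}{(q)_n}(-1)^nq^{n(n-1)/2}x^n$. $q$-Borel transformation of $f=\sum_{n\ge0}a_nx^n$: $\mathcal{B}^{+}(f)(\xi)=\sum_{n\ge0}a_nq^{n(n-1)/2}\xi^n$ (continued meromorphically to $\mathbb{C}$). $q$-Laplace transformation: $\mathcal{L}^{+}(f)(x,\lambda)=\sum_{n\in\mathbb{Z}}\frac{f(\lambda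 q^n)}{\theta_q(\lambda q^n/x)}$. *)

theory Defs
  imports "HOL-Complex_Analysis.Complex_Analysis"
begin

definition qpower :: "complex \<Rightarrow> complex \<Rightarrow> complex" where
  "qpower \<tau> s = exp (2 * of_real pi * \<i> * s * \<tau>)"

definition qpoch_inf :: "complex \<Rightarrow> complex \<Rightarrow> complex" where
  "qpoch_inf q x = (\<Prod>j. 1 - x * q ^ j)"

(* The finite product, rather than the quotient (x;q)_\<infinity> / (q^n x;q)_\<infinity>, which would be 0/0
   when x is a nonpositive integral power of q. *)
definition qpoch :: "complex \<Rightarrow> complex \<Rightarrow> nat \<Rightarrow> complex" where
  "qpoch q x n = (\<Prod>j<n. 1 - x * q ^ j)"

definition qtheta :: "complex \<Rightarrow> complex \<Rightarrow> complex" where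
  "qtheta q x = qpoch_inf q q * qpoch_inf q (- x) * qpoch_inf q (- q / x)"

definition qhyp :: "complex \<Rightarrow> complex list \<Rightarrow> complex list \<Rightarrow> complex fps" where
  "qhyp q as bs = Abs_fps (\<lambda>n.
     (\<Prod>a\<leftarrow>as. qpoch q a n) / ((\<Prod>b\<leftarrow>bs. qpoch q b n) * qpoch q q n)
     * ((-1) ^ n * q ^ (n * (n - 1) div 2)) powi (int (length bs) - int (length as) + 1))"

(* The meromorphic function on the whole plane whose germ at 0 is the q-Borel transform of F.
   It is unique if it exists; "nicely" fixes the values at the poles (as 0) and removes the
   removable singularities. *)
definition qBorel :: "complex \<Rightarrow> complex fps \<Rightarrow> complex \<Rightarrow> complex" where
  "qBorel q F = (THE g. g nicely_meromorphic_on UNIV \<and>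
     (\<forall>\<^sub>F \<xi> in nhds 0.
        g \<xi> = eval_fps (Abs_fps (\<lambda>n. fps_nth F n * q ^ (n * (n - 1) div 2))) \<xi>))"

definition qLaplace :: "complex \<Rightarrow> (complex \<Rightarrow> complex) \<Rightarrow> complex \<Rightarrow> complex \<Rightarrow> complex" where
  "qLaplace q f x lam = (\<Sum>\<^sub>\<infinity>n\<in>(UNIV :: int set). f (lam * q powi n) / qtheta q (lam * q powi n / x))"

definition f0_tilde :: "complex \<Rightarrow> complex \<Rightarrow> complex fps" where
  "f0_tilde q a = fps_compose (qhyp q [a, 0] []) (fps_const (1 / a) * fps_X)"

(* The solutions are multivalued in x, so they are functions of a logarithm l of x:
   x = exp l and x^\<beta> = exp (\<beta> * l). Passing from x to 1/x is passing from l to -l, which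
   gives the convention (1/x)^\<beta> = x^(-\<beta>) for every nonzero x (no single-valued choice of
   log achieves this at x = -1). *)
definition f_0 :: "complex \<Rightarrow> complex \<Rightarrow> complex \<Rightarrow> complex \<Rightarrow> complex" where
  "f_0 \<tau> \<alpha> l lam = (let q = qpower \<tau> 1; a = qpower \<tau> \<alpha>; x = exp l in
     exp (\<alpha> / 2 * l) * qLaplace q (qBorel q (f0_tilde q a)) x lam)"

definition f_infinity :: "complex \<Rightarrow> complex \<Rightarrow> complex \<Rightarrow> complex \<Rightarrow> complex" where
  "f_infinity \<tau> \<alpha> l lam = f_0 \<tau> \<alpha> (- l) lam"

definition g_0 :: "complex \<Rightarrow> complex \<Rightarrow> complex \<Rightarrow> complex" where
  "g_0 \<tau> \<alpha> l = (let q = qpower \<tau> 1; a = qpower \<tau> \<alpha>; x = exp l in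
     exp ((1 - \<alpha> / 2) * l) / qtheta q (- x) * eval_fps (qhyp q [q / a] [0]) (x * q))"

definition g_infinity :: "complex \<Rightarrow> complex \<Rightarrow> complex \<Rightarrow> complex" where
  "g_infinity \<tau> \<alpha> l = g_0 \<tau> \<alpha> (- l)"

lemma qpoch_zero [simp]: "qpoch q 0 n = 1"
  by (simp add: qpoch_def)

lemma fps_nth_f0_tilde:
  "fps_nth (f0_tilde q a) n =
     qpoch q a n / qpoch q q n * (-1) ^ n * inverse (q ^ (n * (n - 1) div 2)) * (1 / a) ^ n"
  by (simp add: f0_tilde_def fps_compose_linear qhyp_def power_int_minus divide_simps
      flip: power_mult_distrib)

lemma eval_qhyp_1_1:
  "eval_fps (qhyp q [A] [0]) x =
     (\<Sum>n. qpoch q A n / qpoch q q n * (-1) ^ n * q ^ (n * (n - 1) div 2) * x ^ n)"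
  by (simp add: eval_fps_def qhyp_def mult.assoc)

end

theory Submission
  imports Defs
begin

text \<open>
  The connection formula is a three-term theta relation in disguise.  By the \<open>q\<close>-binomial theorem
  the \<open>q\<close>-Borel transform of \<open>\<^sub>2\<phi>\<^sub>0\<close> is \<open>(-\<xi>)\<^sub>\<infinity> / (-\<xi>/a)\<^sub>\<infinity>\<close>.  The poles in its
  \<open>q\<close>-Laplace transform can be pulled out with the quasi-periodicity of theta
  (\<open>qLaplace_eq_laplace_sum\<close>): the transform at \<open>x\<close>, \<open>\<lambda>\<close> equals
  \<open>(q)\<^sub>\<infinity> G(\<lambda>/x, \<lambda>) / (\<theta>(\<lambda>/a) \<theta>(\<lambda>/x))\<close>, where
  \<open>G(l, m) = \<Sum>n. (-m q^n)\<^sub>\<infinity> (-q^(1-n) a/m)\<^sub>\<infinity> q^(n(n-1)) (l m/a)^n\<close> has no denominators.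
  Three facts about \<open>G\<close> give the theorem.

  Expanding both infinite products by Euler's identity turns \<open>G\<close> into an absolutely convergent triple
  sum.  A linear change of the summation indices shows that \<open>G\<close> is symmetric in \<open>l\<close> and \<open>m\<close>
  (\<open>laplace_sum_commute\<close>).  Summing over \<open>n\<close> first, and distinguishing the parity of the
  difference of the other two indices, shows that \<open>u \<mapsto> G(u/x, u)\<close> lies in the space spanned by
  \<open>\<Sum>n. q^(n(n-1)) (u^2/c)^n\<close> and \<open>u \<Sum>n. q^(n^2) (u^2/c)^n\<close>, where \<open>c = a x\<close>
  (\<open>laplace_sum_theta_expansion\<close>).  This is the space of theta functions of order two with
  \<open>f(q u) = c u^(-2) f(u)\<close>.

  Any three values \<open>f(u)\<close>, \<open>f(v)\<close>, \<open>f(w)\<close> of a function in a two-dimensional space satisfy a linear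
  relation whose coefficients are the \<open>2 \<times> 2\<close> determinants of the basis.  Here such a determinant
  factors as \<open>v \<theta>(-u/v) \<theta>(-u v/c)\<close> (\<open>theta_product\<close>), because a product of two theta series
  splits according to the parity of the sum of the indices.  The theorem is the relation
  between the points \<open>u = \<lambda>'\<close>, \<open>v = -1\<close> and \<open>w = x \<lambda>\<close>.  Up to theta factors, the function
  at \<open>\<lambda>'\<close> is the transform on the left-hand side.  At \<open>x \<lambda>\<close> the symmetry of \<open>G\<close> identifies
  it with the transform that enters \<open>f\<^sub>\<infinity>\<close>.  At \<open>-1\<close> all terms with \<open>n \<le> 0\<close> vanish, and what is left is the
  \<open>\<^sub>1\<phi>\<^sub>1\<close> series of \<open>g\<^sub>\<infinity>\<close> (\<open>laplace_sum_at_minus_one\<close>).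

  The factorisation needs theta as a series, whereas the theorem needs it as a product, so Jacobi's
  triple product identity is proved first, by Andrews's argument from Euler's two expansions.

  Throughout, powers are written as exponentials: with \<open>q = exp Q\<close>, \<open>u = exp U\<close> and so on,
  an identity between monomials reduces to a polynomial identity between exponents, also when
  half-integral coefficients such as those of \<open>n(n-1)/2\<close> occur.
\<close>

section \<open>Summability of Gaussian families\<close>

text \<open>Absolute summability is meant in the sense of unordered sums, not of integrals.\<close>
no_notation Infinite_Set_Sum.abs_summable_on (infix \<open>abs'_summable'_on\<close> 50)

lemma summable_on_even_int:
  fixes h :: "nat \<Rightarrow> real"
  assumes "summable h" "\<And>n. h n \<ge> 0"
  shows "(\<lambda>n::int. h (nat \<bar>n\<bar>)) summable_on UNIV"
proof -
  have h: "h summable_on UNIV"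
    using norm_summable_imp_summable_on[of h] assms by simp
  have "(\<lambda>n::int. h (nat \<bar>n\<bar>)) summable_on range int"
    by (subst summable_on_reindex) (auto simp: o_def h)
  moreover have "(\<lambda>n::int. h (nat \<bar>n\<bar>)) summable_on range (\<lambda>n. - int n)"
    by (subst summable_on_reindex) (auto simp: o_def h inj_on_def)
  moreover have "range int \<union> range (\<lambda>n. - int n) = UNIV"
  proof -
    have "n \<in> range int \<union> range (\<lambda>n. - int n)" for n :: int
      by (cases n rule: int_cases2) auto
    thus ?thesis by blast
  qed
  ultimately show ?thesis
    using summable_on_union by metis
qed

text \<open>
  Completing the square bounds \<open>M n - r n^2\<close> by a constant minus \<open>n\<close>, which leaves a geometric
  series.
\<close>
lemma gauss_summable_nat:
  fixes r M :: real
  assumes "r > 0"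
  shows "summable (\<lambda>n. exp (M * real n - r * (real n)\<^sup>2))"
proof (rule summable_comparison_test')
  define C where "C = exp ((M + 1)\<^sup>2 / (4 * r))"
  show "summable (\<lambda>n. C * exp (-1) ^ n)"
    by (intro summable_mult summable_geometric) auto
  fix n :: nat
  \<comment> \<open>The square that is completed in \<open>(M + 1) n - r n^2\<close>.\<close>
  have "0 \<le> (2 * r * real n - (M + 1))\<^sup>2" by simp
  hence "4 * r * (M * real n - r * (real n)\<^sup>2) \<le> (M + 1)\<^sup>2 - 4 * r * real n"
    by (simp add: power2_eq_square algebra_simps)
  hence "M * real n - r * (real n)\<^sup>2 \<le> ((M + 1)\<^sup>2 - 4 * r * real n) / (4 * r)"
    using assms by (simp add: pos_le_divide_eq mult.commute)
  also have "\<dots> = (M + 1)\<^sup>2 / (4 * r) - real n"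
    using assms by (simp add: field_simps)
  finally have "exp (M * real n - r * (real n)\<^sup>2) \<le> exp ((M + 1)\<^sup>2 / (4 * r) - real n)"
    by simp
  also have "\<dots> = C * exp (-1) ^ n"
    by (simp add: C_def exp_diff exp_minus field_simps flip: exp_of_nat_mult)
  finally show "norm (exp (M * real n - r * (real n)\<^sup>2)) \<le> C * exp (-1) ^ n"
    by simp
qed

lemma gauss_summable:
  fixes r M :: real
  assumes "r > 0"
  shows "(\<lambda>n::int. exp (M * \<bar>real_of_int n\<bar> - r * (real_of_int n)\<^sup>2)) summable_on UNIV"
  using summable_on_even_int[OF gauss_summable_nat[OF assms, of M]] by (simp add: of_nat_nat)

lemma gauss_exp_abs_summable:
  fixes A B :: complex
  assumes "Re A < 0"
  shows "(\<lambda>n::int. exp ((of_int n)\<^sup>2 * A + of_int n * B)) abs_summable_on UNIV"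
proof (rule Infinite_Sum.abs_summable_on_comparison_test')
  show "(\<lambda>n::int. exp (\<bar>Re B\<bar> * \<bar>real_of_int n\<bar> - (- Re A) * (real_of_int n)\<^sup>2)) summable_on UNIV"
    by (rule gauss_summable) (use assms in auto)
  fix n :: int
  have "Re ((of_int n)\<^sup>2 * A + of_int n * B) = Re A * (real_of_int n)\<^sup>2 + real_of_int n * Re B"
    by (simp add: power2_eq_square)
  moreover have "real_of_int n * Re B \<le> \<bar>Re B\<bar> * \<bar>real_of_int n\<bar>"
    by (metis abs_ge_self abs_mult mult.commute)
  ultimately show "norm (exp ((of_int n)\<^sup>2 * A + of_int n * B))
      \<le> exp (\<bar>Re B\<bar> * \<bar>real_of_int n\<bar> - (- Re A) * (real_of_int n)\<^sup>2)"
    by simp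
qed

lemma abs_summable_on_times:
  fixes f g :: "_ \<Rightarrow> complex"
  assumes "f abs_summable_on A" "g abs_summable_on B"
  shows "(\<lambda>(x, y). f x * g y) abs_summable_on (A \<times> B)"
proof (subst Infinite_Sum.abs_summable_on_Sigma_iff, intro conjI ballI)
  show "(\<lambda>y. case (x, y) of (x, y) \<Rightarrow> f x * g y) abs_summable_on B" for x
    using assms(2) by (simp add: norm_mult summable_on_cmult_right)
  show "(\<lambda>x. \<Sum>\<^sub>\<infinity>y\<in>B. norm (case (x, y) of (x, y) \<Rightarrow> f x * g y)) abs_summable_on A"
    using assms(1) by (simp add: norm_mult infsum_cmult_right' summable_on_cmult_left
        infsum_nonneg abs_mult)
qed

lemma has_sum_times:
  fixes f g :: "_ \<Rightarrow> complex"
  assumes "(f has_sum a) A" "(g has_sum b) B" "f abs_summable_on A" "g abs_summable_on B"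
  shows "((\<lambda>(x, y). f x * g y) has_sum (a * b)) (A \<times> B)"
proof (rule has_sum_SigmaI)
  show "((\<lambda>y. case (x, y) of (x, y) \<Rightarrow> f x * g y) has_sum (f x * b)) B" for x
    using has_sum_cmult_right[OF assms(2)] by simp
  show "((\<lambda>x. f x * b) has_sum (a * b)) A"
    by (rule has_sum_cmult_left[OF assms(1)])
  show "(\<lambda>(x, y). f x * g y) summable_on A \<times> B"
    by (rule abs_summable_summable[OF abs_summable_on_times[OF assms(3,4)]])
qed

text \<open>
  The quadratic form that governs the triple sum is
  \<open>((i + n)^2 + (j - n)^2) / 2\<close>.  It has rank two, hence is degenerate on \<open>\<int>\<^sup>3\<close>; it
  is definite on the region \<open>i, j \<ge> 0\<close> over which the sum extends.  For \<open>n \<ge> 0\<close> the term \<open>i n\<close>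
  can be dropped and the rest is definite; the case \<open>n \<le> 0\<close> follows by exchanging \<open>i\<close> and \<open>j\<close>.
\<close>
lemma laplace_sum_quadratic_bound_nonneg:
  fixes i j n :: real
  assumes "i \<ge> 0" "j \<ge> 0" "n \<ge> 0"
  shows "(i\<^sup>2 + j\<^sup>2 + n\<^sup>2) / 8 \<le> i\<^sup>2 / 2 + j\<^sup>2 / 2 + i * n - j * n + n\<^sup>2"
proof -
  have lin: "(p + s + t) / 8 \<le> p / 2 + s / 2 + v - w + t"
    if "0 \<le> 3 * s - 8 * w + 16 / 3 * t" "0 \<le> v" "0 \<le> p" "0 \<le> t" for p s t v w :: real
    using that by (simp add: field_simps)
  have "0 \<le> 3 * (j - 4 / 3 * n)\<^sup>2" by (intro mult_nonneg_nonneg) auto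
  also have "\<dots> = 3 * j\<^sup>2 - 8 * (j * n) + 16 / 3 * n\<^sup>2"
    by (simp add: power2_eq_square algebra_simps)
  finally show ?thesis
    by (rule lin) (use assms in auto)
qed

lemma laplace_sum_quadratic_bound:
  fixes i j n :: real
  assumes "i \<ge> 0" "j \<ge> 0"
  shows "(i\<^sup>2 + j\<^sup>2 + n\<^sup>2) / 8 \<le> i\<^sup>2 / 2 + j\<^sup>2 / 2 + i * n - j * n + n\<^sup>2"
proof (cases "n \<ge> 0")
  case False
  thus ?thesis using laplace_sum_quadratic_bound_nonneg[of j i "- n"] assms by (simp add: add_ac)
qed (rule laplace_sum_quadratic_bound_nonneg[OF assms])

section \<open>Uniqueness of meromorphic continuation\<close>

text \<open>
  Removing the singularities of the difference gives a nicely meromorphic function that vanishes near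
  \<open>z0\<close>, hence everywhere.  So the two functions agree in every punctured neighbourhood, and their
  values at the centre are determined by that: zero at a pole, the limit otherwise.
\<close>
lemma nicely_meromorphic_eqI:
  assumes f: "f nicely_meromorphic_on UNIV" and g: "g nicely_meromorphic_on UNIV"
    and ev: "eventually (\<lambda>z. f z = g z) (nhds z0)"
  shows "f = g"
proof
  fix z :: complex
  define d where "d = (\<lambda>z. f z - g z)"
  have mero: "d meromorphic_on UNIV"
    unfolding d_def using f g by (intro meromorphic_intros) (auto simp: nicely_meromorphic_on_def)
  have iso: "isolated_singularity_at d w" for w
    by (rule meromorphic_on_isolated_singularity[OF meromorphic_on_subset[OF mero]]) simp
  have "eventually (\<lambda>w. d w = 0) (at z0)"
    using ev by (auto simp: d_def eventually_at_filter elim: eventually_mono)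
  with eventually_remove_sings_eq_at[OF iso[of z0]]
  have "eventually (\<lambda>w. remove_sings d w = 0) (at z0)"
    by eventually_elim simp
  hence "frequently (\<lambda>w. remove_sings d w = 0) (at z0)"
    by (rule eventually_frequently[rotated]) simp
  hence zero: "remove_sings d w = 0" for w
    by (rule frequently_eq_meromorphic_imp_constant[OF _ remove_sings_nicely_meromorphic[OF mero]
          open_UNIV connected_UNIV UNIV_I UNIV_I])
  from eventually_remove_sings_eq_at[OF iso[of z]]
  have eq: "eventually (\<lambda>w. f w = g w) (at z)"
    by eventually_elim (use zero in \<open>simp add: d_def\<close>)
  have pole: "is_pole f z \<longleftrightarrow> is_pole g z"
    by (rule is_pole_cong[OF eq refl])
  have no_pole: "\<not> is_pole h z" if "h \<midarrow>z\<rightarrow> h z" for h :: "complex \<Rightarrow> complex"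
    using that not_tendsto_and_filterlim_at_infinity[of "at z" h "h z"] by (auto simp: is_pole_def)
  have "is_pole f z \<and> f z = 0 \<or> f \<midarrow>z\<rightarrow> f z" "is_pole g z \<and> g z = 0 \<or> g \<midarrow>z\<rightarrow> g z"
    using f g by (auto simp: nicely_meromorphic_on_def)
  moreover have "f z = g z" if "f \<midarrow>z\<rightarrow> f z" "g \<midarrow>z\<rightarrow> g z"
  proof -
    have "g \<midarrow>z\<rightarrow> f z"
      using that(1) by (rule tendsto_cong[OF eq, THEN iffD1])
    thus ?thesis by (rule LIM_unique[OF _ that(2)])
  qed
  ultimately show "f z = g z"
    using pole no_pole by metis
qed

section \<open>Infinite products and the q-binomial theorem\<close>

text \<open>
  A logarithm \<open>Q\<close> of \<open>q\<close> is fixed, so that \<open>q^(n(n-1)/2)\<close> can be handled as the exponential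
  of a polynomial in \<open>n\<close>.
\<close>
locale nome =
  fixes Q q :: complex
  assumes q_eq: "q = exp Q" and Re_Q: "Re Q < 0"
begin

lemma q_nz [simp]: "q \<noteq> 0"
  by (simp add: q_eq)

lemma norm_q: "norm q < 1"
  using Re_Q by (simp add: q_eq)

lemma q_power_tendsto_0: "(\<lambda>n. x * q ^ n) \<longlonglongrightarrow> 0"
  using tendsto_mult_right_zero[OF LIMSEQ_power_zero[OF norm_q]] by simp

lemma convergent_prod_qpoch: "convergent_prod (\<lambda>j. 1 - x * q ^ j)"
proof (rule abs_convergent_prod_imp_convergent_prod, rule summable_imp_abs_convergent_prod)
  have "summable (\<lambda>i. norm x * norm q ^ i)"
    by (intro summable_mult summable_geometric) (use norm_q in auto)
  thus "summable (\<lambda>i. norm (1 - x * q ^ i - 1))"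
    by (simp add: norm_mult norm_power)
qed

lemma qpoch_tendsto: "qpoch q x \<longlonglongrightarrow> qpoch_inf q x"
proof -
  have "(\<lambda>n. \<Prod>j\<le>n. 1 - x * q ^ j) \<longlonglongrightarrow> qpoch_inf q x"
    unfolding qpoch_inf_def by (rule convergent_prod_LIMSEQ[OF convergent_prod_qpoch])
  hence "(\<lambda>n. qpoch q x (Suc n)) \<longlonglongrightarrow> qpoch_inf q x"
    by (simp add: qpoch_def lessThan_Suc_atMost)
  thus ?thesis by (rule LIMSEQ_imp_Suc)
qed

lemma qpoch_add: "qpoch q x (n + m) = qpoch q x n * qpoch q (x * q ^ n) m"
  by (induction m) (simp_all add: qpoch_def power_add mult_ac)

lemma qpoch_inf_split: "qpoch_inf q x = qpoch q x n * qpoch_inf q (x * q ^ n)"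
proof -
  have "(\<lambda>m. qpoch q x (m + n)) \<longlonglongrightarrow> qpoch_inf q x"
    using qpoch_tendsto LIMSEQ_ignore_initial_segment by blast
  moreover have "(\<lambda>m. qpoch q x (m + n)) \<longlonglongrightarrow> qpoch q x n * qpoch_inf q (x * q ^ n)"
    unfolding add.commute[of _ n] qpoch_add by (intro tendsto_intros qpoch_tendsto)
  ultimately show ?thesis by (rule LIMSEQ_unique)
qed

lemma qpoch_inf_rec: "qpoch_inf q x = (1 - x) * qpoch_inf q (x * q)"
  using qpoch_inf_split[of x 1] by (simp add: qpoch_def)

lemma qpoch_q_nz [simp]: "qpoch q q n \<noteq> 0"
proof -
  have "q * q ^ j \<noteq> 1" for j
    using power_Suc_less_one[of "norm q" j] norm_q
    by (metis norm_ge_zero norm_one norm_power order_less_irrefl power_Suc power_less_one_iff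
        nat.distinct(1) zero_less_Suc)
  thus ?thesis by (simp add: qpoch_def)
qed

lemma qpoch_inf_0 [simp]: "qpoch_inf q 0 = 1"
  by (simp add: qpoch_inf_def)

text \<open>
  The homogeneous form \<open>\<Prod>j<n. b - c q^j\<close> of the numerator covers three classical expansions at
  once: \<open>b = 1\<close> gives the \<open>q\<close>-binomial theorem, \<open>b = 1, c = 0\<close> and \<open>b = 0, c = -1\<close> give the two
  expansions of Euler.
\<close>
definition binom_coeff :: "complex \<Rightarrow> complex \<Rightarrow> nat \<Rightarrow> complex" where
  "binom_coeff b c n = (\<Prod>j<n. b - c * q ^ j) / qpoch q q n"

lemma binom_coeff_0 [simp]: "binom_coeff b c 0 = 1"
  by (simp add: binom_coeff_def qpoch_def)

lemma one_minus_q_power_nz: "1 - q ^ Suc n \<noteq> 0"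
  using qpoch_q_nz[of "Suc n"] by (auto simp: qpoch_def)

lemma binom_coeff_Suc': "binom_coeff b c (Suc n) = binom_coeff b c n * ((b - c * q ^ n) / (1 - q ^ Suc n))"
  by (simp add: binom_coeff_def qpoch_def)

lemma binom_coeff_Suc: "binom_coeff b c (Suc n) * (1 - q ^ Suc n) = binom_coeff b c n * (b - c * q ^ n)"
  using one_minus_q_power_nz[of n] by (simp add: binom_coeff_Suc')

lemma norm_summable_binom_coeff:
  assumes "norm (b * z) < 1"
  shows "summable (\<lambda>n. norm (binom_coeff b c n * z ^ n))"
proof -
  define r where "r n = norm ((b - c * q ^ n) / (1 - q * q ^ n) * z)" for n
  have "r \<longlonglongrightarrow> norm ((b - 0) / (1 - 0) * z)"
    unfolding r_def by (intro tendsto_intros q_power_tendsto_0) auto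
  moreover obtain d where d: "norm (b * z) < d" "d < 1"
    using assms dense by blast
  ultimately have "eventually (\<lambda>n. r n < d) sequentially"
    by (intro order_tendstoD(2)[of r "norm (b * z)"]) auto
  then obtain N where N: "\<And>n. n \<ge> N \<Longrightarrow> r n < d"
    by (auto simp: eventually_sequentially)
  show ?thesis
  proof (rule summable_ratio_test[OF d(2)])
    fix n assume "n \<ge> N"
    have "binom_coeff b c (Suc n) * z ^ Suc n
        = ((b - c * q ^ n) / (1 - q * q ^ n) * z) * (binom_coeff b c n * z ^ n)"
      by (simp add: binom_coeff_Suc')
    hence "norm (binom_coeff b c (Suc n) * z ^ Suc n) = r n * norm (binom_coeff b c n * z ^ n)"
      unfolding r_def by (simp only: norm_mult)
    also have "\<dots> \<le> d * norm (binom_coeff b c n * z ^ n)"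
      using N[OF \<open>n \<ge> N\<close>] by (intro mult_right_mono) auto
    finally show "norm (norm (binom_coeff b c (Suc n) * z ^ Suc n))
        \<le> d * norm (norm (binom_coeff b c n * z ^ n))" by simp
  qed
qed

lemma norm_q_mult_less: "norm (b * z) < 1 \<Longrightarrow> norm (b * (z * q ^ n)) < 1"
proof -
  assume "norm (b * z) < 1"
  moreover have "norm (b * (z * q ^ n)) \<le> norm (b * z)"
    using norm_q by (simp add: norm_mult norm_power power_le_one mult_left_le flip: mult.assoc)
  ultimately show ?thesis by linarith
qed

text \<open>
  The recursion of the coefficients says \<open>(1 - b z) F(z) = (1 - c z) F(q z)\<close> for the sum \<open>F\<close>.
  Iterating it and using \<open>F(q^n z) \<rightarrow> F(0) = 1\<close> yields the product.
\<close>
theorem q_binomial_suminf: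
  assumes "norm (b * z) < 1"
  shows "qpoch_inf q (b * z) * (\<Sum>n. binom_coeff b c n * z ^ n) = qpoch_inf q (c * z)"
proof -
  define F where "F z = (\<Sum>n. binom_coeff b c n * z ^ n)" for z
  have step: "(1 - b * z) * F z = (1 - c * z) * F (z * q)" if z: "norm (b * z) < 1" for z
  proof -
    have S: "summable (\<lambda>n. binom_coeff b c n * z ^ n)"
      by (rule summable_norm_cancel[OF norm_summable_binom_coeff[OF z]])
    have S': "summable (\<lambda>n. binom_coeff b c n * (z * q) ^ n)"
      using summable_norm_cancel[OF norm_summable_binom_coeff[of b "z * q" c]]
        norm_q_mult_less[OF z, of 1] by simp
    have "F z - F (z * q) = (\<Sum>n. binom_coeff b c n * z ^ n - binom_coeff b c n * (z * q) ^ n)"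
      unfolding F_def by (rule suminf_diff[OF S S'])
    also have "\<dots> = (\<Sum>n. binom_coeff b c (Suc n) * z ^ Suc n - binom_coeff b c (Suc n) * (z * q) ^ Suc n)"
      by (subst suminf_split_head) (use summable_diff[OF S S'] in auto)
    also have "\<dots> = (\<Sum>n. z * b * (binom_coeff b c n * z ^ n) - z * c * (binom_coeff b c n * (z * q) ^ n))"
    proof (intro suminf_cong)
      fix n
      have "binom_coeff b c (Suc n) * z ^ Suc n - binom_coeff b c (Suc n) * (z * q) ^ Suc n
          = (binom_coeff b c (Suc n) * (1 - q ^ Suc n)) * z ^ Suc n"
        by (simp add: algebra_simps power_mult_distrib)
      also have "\<dots> = z * b * (binom_coeff b c n * z ^ n) - z * c * (binom_coeff b c n * (z * q) ^ n)"
        unfolding binom_coeff_Suc by (simp add: algebra_simps power_mult_distrib)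
      finally show "binom_coeff b c (Suc n) * z ^ Suc n - binom_coeff b c (Suc n) * (z * q) ^ Suc n
          = z * b * (binom_coeff b c n * z ^ n) - z * c * (binom_coeff b c n * (z * q) ^ n)" .
    qed
    also have "\<dots> = z * b * F z - z * c * F (z * q)"
      unfolding F_def suminf_mult[OF S, symmetric] suminf_mult[OF S', symmetric]
      by (rule suminf_diff[symmetric]; intro summable_mult S S')
    finally show ?thesis by (simp add: algebra_simps)
  qed
  have iter: "qpoch q (b * z) n * F z = qpoch q (c * z) n * F (z * q ^ n)" for n
  proof (induction n)
    case (Suc n)
    have "qpoch q (b * z) (Suc n) * F z = (1 - b * (z * q ^ n)) * (qpoch q (b * z) n * F z)"
      by (simp add: qpoch_def algebra_simps)
    also have "\<dots> = qpoch q (c * z) n * ((1 - b * (z * q ^ n)) * F (z * q ^ n))"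
      unfolding Suc.IH by (simp add: algebra_simps)
    also have "\<dots> = qpoch q (c * z) (Suc n) * F (z * q ^ Suc n)"
      unfolding step[OF norm_q_mult_less[OF assms]] by (simp add: qpoch_def algebra_simps)
    finally show ?case .
  qed (simp add: qpoch_def)
  have F0: "F 0 = 1"
    unfolding F_def by simp
  \<comment> \<open>Continuity of the power series at 0 requires convergence at some nonzero point.\<close>
  have "isCont F 0"
  proof (cases "z = 0")
    case False
    thus ?thesis unfolding F_def
      by (intro isCont_powser[of _ z] summable_norm_cancel[OF norm_summable_binom_coeff[OF assms]]) auto
  next
    case True
    obtain K :: complex where K: "K \<noteq> 0" "norm (b * K) < 1"
    proof (cases "b = 0")
      case False
      thus ?thesis by (intro that[of "1 / (2 * b)"]) (auto simp: norm_divide norm_mult)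
    qed (use that[of 1] in auto)
    thus ?thesis unfolding F_def
      by (intro isCont_powser[of _ K] summable_norm_cancel[OF norm_summable_binom_coeff[OF K(2)]]) auto
  qed
  hence "(\<lambda>n. F (z * q ^ n)) \<longlonglongrightarrow> F 0"
    using isCont_tendsto_compose q_power_tendsto_0 by blast
  hence "(\<lambda>n. qpoch q (c * z) n * F (z * q ^ n)) \<longlonglongrightarrow> qpoch_inf q (c * z) * F 0"
    by (intro tendsto_intros qpoch_tendsto)
  moreover have "(\<lambda>n. qpoch q (b * z) n * F z) \<longlonglongrightarrow> qpoch_inf q (b * z) * F z"
    by (intro tendsto_intros qpoch_tendsto)
  ultimately have "qpoch_inf q (b * z) * F z = qpoch_inf q (c * z) * F 0"
    unfolding iter by (rule LIMSEQ_unique[symmetric])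
  thus ?thesis by (simp add: F0 F_def)
qed

section \<open>Euler's expansions and the Jacobi triple product\<close>

text \<open>
  The power \<open>q^(n(n-1)/2)\<close> for integral \<open>n\<close>.
\<close>
definition qtri :: "int \<Rightarrow> complex" where
  "qtri n = exp (of_int n * (of_int n - 1) / 2 * Q)"

lemma qtri_0 [simp]: "qtri 0 = 1" and qtri_1 [simp]: "qtri 1 = 1" and qtri_nz [simp]: "qtri n \<noteq> 0"
  by (simp_all add: qtri_def)

lemma q_powi: "q powi n = exp (of_int n * Q)"
  by (simp add: q_eq exp_power_int)

lemma q_power: "q ^ n = exp (of_nat n * Q)"
  by (simp add: q_eq exp_of_nat_mult)

lemma qtri_Suc: "qtri (int (Suc n)) = qtri (int n) * q ^ n"
  by (simp add: qtri_def q_power field_simps flip: exp_add)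

lemma binom_coeff_0_m1: "binom_coeff 0 (-1) n = qtri (int n) / qpoch q q n"
proof -
  have "(\<Prod>j<n. q ^ j) = qtri (int n)"
    by (induction n) (simp_all add: qtri_Suc del: of_nat_Suc)
  thus ?thesis by (simp add: binom_coeff_def)
qed

lemma euler_abs_summable: "(\<lambda>n. binom_coeff 0 (-1) n * z ^ n) abs_summable_on UNIV"
  using norm_summable_binom_coeff[of 0 z "-1"] by (simp add: norm_summable_imp_summable_on)

lemma euler_has_sum: "((\<lambda>n. binom_coeff 0 (-1) n * z ^ n) has_sum qpoch_inf q (- z)) UNIV"
proof (rule norm_summable_imp_has_sum)
  show S: "summable (\<lambda>n. norm (binom_coeff 0 (-1) n * z ^ n))"
    by (rule norm_summable_binom_coeff) auto
  show "(\<lambda>n. binom_coeff 0 (-1) n * z ^ n) sums qpoch_inf q (- z)"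
    using q_binomial_suminf[of 0 z "-1"] summable_norm_cancel[OF S] by (simp add: sums_iff)
qed

lemma qpoch_inf_nz: "norm z < 1 \<Longrightarrow> qpoch_inf q z \<noteq> 0"
  using q_binomial_suminf[of 1 z 0] by auto

lemma euler_inverse_abs_summable:
  "norm z < 1 \<Longrightarrow> (\<lambda>n. binom_coeff 1 0 n * z ^ n) abs_summable_on UNIV"
  using norm_summable_binom_coeff[of 1 z 0] by (simp add: norm_summable_imp_summable_on)

lemma euler_inverse_has_sum:
  assumes "norm z < 1"
  shows "((\<lambda>n. binom_coeff 1 0 n * z ^ n) has_sum (1 / qpoch_inf q z)) UNIV"
proof (rule norm_summable_imp_has_sum)
  show S: "summable (\<lambda>n. norm (binom_coeff 1 0 n * z ^ n))"
    using assms by (intro norm_summable_binom_coeff) auto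
  show "(\<lambda>n. binom_coeff 1 0 n * z ^ n) sums (1 / qpoch_inf q z)"
    using q_binomial_suminf[of 1 z 0] summable_norm_cancel[OF S] assms qpoch_inf_nz[OF assms]
    by (simp add: sums_iff field_simps)
qed

definition theta_series :: "complex \<Rightarrow> complex" where
  "theta_series z = (\<Sum>\<^sub>\<infinity>n. qtri n * z powi n)"

lemma theta_term_exp:
  "qtri n * exp Z powi n = exp ((of_int n)\<^sup>2 * (Q / 2) + of_int n * (Z - Q / 2))"
proof -
  have "of_int n * (of_int n - 1) / 2 * Q + of_int n * Z
      = (of_int n)\<^sup>2 * (Q / 2) + of_int n * (Z - Q / 2)"
    by (simp add: power2_eq_square field_simps)
  thus ?thesis by (simp only: qtri_def exp_power_int exp_add[symmetric])
qed

lemma theta_abs_summable: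
  assumes "z \<noteq> 0"
  shows "(\<lambda>n. qtri n * z powi n) abs_summable_on UNIV"
proof -
  have "exp (ln z) = z" using assms by simp
  thus ?thesis
    using gauss_exp_abs_summable[of "Q / 2" "ln z - Q / 2"] Re_Q
    unfolding theta_term_exp[of _ "ln z", symmetric] by simp
qed

lemma theta_has_sum: "z \<noteq> 0 \<Longrightarrow> ((\<lambda>n. qtri n * z powi n) has_sum theta_series z) UNIV"
  unfolding theta_series_def by (rule has_sum_infsum[OF abs_summable_summable[OF theta_abs_summable]])

text \<open>
  Quasi-periodicity: the shift \<open>n \<mapsto> n + k\<close> multiplies
  the general term by \<open>q^(k(k-1)/2) z^k q^(k n)\<close>.
\<close>
lemma theta_series_shift:
  assumes "z \<noteq> 0"
  shows "qtri k * z powi k * theta_series (q powi k * z) = theta_series z"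
proof -
  have "qtri k * z powi k * theta_series (q powi k * z)
      = (\<Sum>\<^sub>\<infinity>n. qtri k * z powi k * (qtri n * (q powi k * z) powi n))"
    unfolding theta_series_def by (rule infsum_cmult_right'[symmetric])
  also have "\<dots> = (\<Sum>\<^sub>\<infinity>n. qtri n * z powi n)"
  proof (rule infsum_reindex_bij_witness[of UNIV "\<lambda>n. n - k" "\<lambda>n. n + k"], goal_cases)
    case (5 n)
    have z: "z = exp (ln z)" using assms by simp
    have "(q powi k * z) powi n = exp (of_int n * (of_int k * Q + ln z))"
      by (subst z, simp only: q_powi exp_add[symmetric] exp_power_int)
    moreover have "z powi m = exp (of_int m * ln z)" for m
      by (subst z, simp only: exp_power_int)
    ultimately show ?case
      by (simp add: qtri_def algebra_simps add_divide_distrib diff_divide_distrib flip: exp_add)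
  qed auto
  finally show ?thesis by (simp add: theta_series_def)
qed

lemma qtheta_shift: "z \<noteq> 0 \<Longrightarrow> z * qtheta q (q * z) = qtheta q z"
proof -
  assume z: "z \<noteq> 0"
  have 1: "qpoch_inf q (- z) = (1 + z) * qpoch_inf q (- (q * z))"
    using qpoch_inf_rec[of "- z"] by (simp add: mult.commute)
  have 2: "z * qpoch_inf q (- q / (q * z)) = (1 + z) * qpoch_inf q (- q / z)"
    using qpoch_inf_rec[of "- 1 / z"] z by (simp add: field_simps)
  have "z * qtheta q (q * z) = qpoch_inf q q * qpoch_inf q (- (q * z)) * (z * qpoch_inf q (- q / (q * z)))"
    by (simp add: qtheta_def)
  also have "\<dots> = qtheta q z"
    unfolding 2 by (simp add: qtheta_def 1)
  finally show ?thesis .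
qed

lemma qpoch_inf_q_neg: "qpoch_inf q (q powi (- int n)) = 0"
  by (subst qpoch_inf_split[of _ "Suc n"]) (auto simp: qpoch_def power_int_minus intro!: bexI[of _ n])

lemma qpoch_inf_q_Suc: "qpoch_inf q (q ^ Suc n) = qpoch_inf q q / qpoch q q n"
  using qpoch_inf_split[of q n] by (simp add: field_simps)

text \<open>
  By Euler, \<open>\<theta>(z) / (-q/z)\<^sub>\<infinity>\<close> (with theta as a series) is a double sum that splits as a product in
  the indices \<open>m\<close> and \<open>N\<close>, absolutely convergent if \<open>\<bar>q/z\<bar> < 1\<close>.  Substituting \<open>N = n + m\<close> and
  summing over \<open>m\<close> by Euler's other expansion leaves \<open>\<Sum>n. (q^(n+1))\<^sub>\<infinity> q^(n(n-1)/2) z^n\<close>.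
  The product \<open>(q^(n+1))\<^sub>\<infinity>\<close> is zero for \<open>n < 0\<close> and equals \<open>(q)\<^sub>\<infinity> / (q)\<^sub>n\<close> for
  \<open>n \<ge> 0\<close>, so the sum is \<open>(q)\<^sub>\<infinity> (-z)\<^sub>\<infinity>\<close>.
\<close>
lemma jacobi_triple_aux:
  assumes z: "norm z > norm q"
  shows "qtheta q z = theta_series z"
proof -
  have z0: "z \<noteq> 0" using z by auto
  have y: "norm (- q / z) < 1" using z z0 by (simp add: norm_divide)
  define f where "f m N = (binom_coeff 1 0 m * (- q / z) ^ m) * (qtri N * z powi N)" for m N
  have H: "((\<lambda>(m, N). f m N) has_sum (1 / qpoch_inf q (- q / z) * theta_series z)) (UNIV \<times> UNIV)"
    unfolding f_def
    by (intro has_sum_times euler_inverse_has_sum theta_has_sum euler_inverse_abs_summable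
        theta_abs_summable y z0)
  have H1: "((\<lambda>(n, m). f m (n + int m)) has_sum (1 / qpoch_inf q (- q / z) * theta_series z)) (UNIV \<times> UNIV)"
  proof -
    have "((\<lambda>(n, m). f m (n + int m)) has_sum (1 / qpoch_inf q (- q / z) * theta_series z)) (UNIV \<times> UNIV)
      \<longleftrightarrow> ((\<lambda>(m, N). f m N) has_sum (1 / qpoch_inf q (- q / z) * theta_series z)) (UNIV \<times> UNIV)"
      by (rule has_sum_reindex_bij_witness[of _ "\<lambda>(m, N). (N - int m, m)" "\<lambda>(n, m). (m, n + int m)"])
        (auto simp del: times_divide_eq_left)
    thus ?thesis using H by blast
  qed
  have H2: "((\<lambda>m. case (n, m) of (n, m) \<Rightarrow> f m (n + int m))
      has_sum (qpoch_inf q (q powi (n + 1)) * (qtri n * z powi n))) UNIV" for n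
  proof -
    have "f m (n + int m) = binom_coeff 0 (-1) m * (- (q powi (n + 1))) ^ m * (qtri n * z powi n)" for m
    proof -
      have "z powi (n + int m) = z powi n * z ^ m"
        using z0 by (simp add: power_int_add)
      moreover have "qtri (n + int m) * q ^ m = qtri n * qtri (int m) * (q powi (n + 1)) ^ m"
        by (simp add: qtri_def q_powi q_power algebra_simps add_divide_distrib diff_divide_distrib
            flip: exp_add exp_of_nat_mult)
      moreover have "binom_coeff 1 0 m = 1 / qpoch q q m"
        by (simp add: binom_coeff_def)
      moreover have "(- q / z) ^ m = (-1) ^ m * q ^ m / z ^ m"
        using power_minus[of q m] by (simp only: power_divide)
      moreover have "(- (q powi (n + 1))) ^ m = (-1) ^ m * (q powi (n + 1)) ^ m"
        by (rule power_minus)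
      ultimately have "f m (n + int m) = (1 / qpoch q q m * (-1) ^ m / z ^ m) * (z powi n * z ^ m)
          * (qtri (n + int m) * q ^ m)"
        by (simp only: f_def) (simp add: field_simps)
      thus ?thesis using z0 \<open>qtri (n + int m) * q ^ m = _\<close> \<open>(- (q powi (n + 1))) ^ m = _\<close>
        by (simp only: binom_coeff_0_m1) (simp add: field_simps)
    qed
    thus ?thesis
      using has_sum_cmult_left[OF euler_has_sum[of "- (q powi (n + 1))"]] by simp
  qed
  have "((\<lambda>n. qpoch_inf q (q powi (n + 1)) * (qtri n * z powi n))
      has_sum (1 / qpoch_inf q (- q / z) * theta_series z)) UNIV"
    by (rule has_sum_SigmaD[OF H1 H2])
  moreover have "((\<lambda>n. qpoch_inf q (q powi (n + 1)) * (qtri n * z powi n))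
      has_sum (qpoch_inf q q * qpoch_inf q (- z))) UNIV"
  proof -
    have "((\<lambda>n. qpoch_inf q q * (binom_coeff 0 (-1) n * z ^ n))
      has_sum (qpoch_inf q q * qpoch_inf q (- z))) UNIV"
      by (intro has_sum_cmult_right euler_has_sum)
    also have "?this \<longleftrightarrow> ((\<lambda>n. qpoch_inf q (q powi (n + 1)) * (qtri n * z powi n))
      has_sum (qpoch_inf q q * qpoch_inf q (- z))) {0..}"
    proof (rule has_sum_reindex_bij_witness[of _ nat int], goal_cases)
      case (5 n)
      have "q powi (int n + 1) = q ^ Suc n"
        by (simp add: power_int_add)
      thus ?case
        by (simp only: qpoch_inf_q_Suc) (simp add: binom_coeff_0_m1)
    qed auto
    also have "\<dots> \<longleftrightarrow> ((\<lambda>n. qpoch_inf q (q powi (n + 1)) * (qtri n * z powi n))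
      has_sum (qpoch_inf q q * qpoch_inf q (- z))) UNIV"
    proof (rule has_sum_cong_neutral)
      fix n :: int assume "n \<in> UNIV - {0..}"
      thus "qpoch_inf q (q powi (n + 1)) * (qtri n * z powi n) = 0"
        using qpoch_inf_q_neg[of "nat (- n - 1)"] by (simp add: add.commute)
    qed auto
    finally show ?thesis .
  qed
  ultimately have "1 / qpoch_inf q (- q / z) * theta_series z = qpoch_inf q q * qpoch_inf q (- z)"
    by (rule has_sum_unique)
  thus ?thesis
    using qpoch_inf_nz[OF y] by (simp add: qtheta_def field_simps)
qed

text \<open>
  Both sides satisfy \<open>z f(q z) = f(z)\<close>, and every nonzero \<open>z\<close> is a power of \<open>q\<close> times a number outside
  the disc of radius \<open>\<bar>q\<bar>\<close>.
\<close>
theorem jacobi_triple_product: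
  assumes "z \<noteq> 0"
  shows "qtheta q z = theta_series z"
proof -
  have *: "qtheta q (q ^ n * w) = theta_series (q ^ n * w)" if w: "norm w > norm q" for n w
  proof (induction n)
    case (Suc n)
    let ?v = "q ^ n * w"
    have v: "?v \<noteq> 0" using w by auto
    have "?v * qtheta q (q * ?v) = ?v * theta_series (q * ?v)"
      using qtheta_shift[OF v] theta_series_shift[OF v, of 1] Suc.IH by simp
    thus ?case using v by (simp add: mult_ac)
  qed (use jacobi_triple_aux w in simp)
  obtain n where "norm q ^ n < norm z"
    using real_arch_pow_inv[of "norm z" "norm q"] assms norm_q by auto
  hence "norm (z / q ^ n) > 1"
    by (simp add: norm_divide norm_power)
  hence "norm (z / q ^ n) > norm q"
    using norm_q by linarith
  from *[OF this, of n] show ?thesis by simp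
qed

lemma qtheta_powi_shift:
  assumes "z \<noteq> 0"
  shows "qtri k * z powi k * qtheta q (q powi k * z) = qtheta q z"
proof -
  have nz: "q powi k * z \<noteq> 0" using assms by simp
  show ?thesis
    unfolding jacobi_triple_product[OF assms] jacobi_triple_product[OF nz]
    by (rule theta_series_shift[OF assms])
qed

section \<open>Theta functions of order two\<close>

text \<open>
  The even and the odd holomorphic solution of \<open>f(q u) = c u^(-2) f(u)\<close> on the punctured plane, a
  basis of the space of all such solutions.
\<close>
definition theta_even :: "complex \<Rightarrow> complex \<Rightarrow> complex" where
  "theta_even c u = (\<Sum>\<^sub>\<infinity>n. (qtri n)\<^sup>2 * (u\<^sup>2 / c) powi n)"

definition theta_odd :: "complex \<Rightarrow> complex \<Rightarrow> complex" where
  "theta_odd c u = u * (\<Sum>\<^sub>\<infinity>n. q powi (n * n) * (u\<^sup>2 / c) powi n)"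

lemma square_theta_abs_summable:
  assumes "z \<noteq> 0"
  shows "(\<lambda>n. (qtri n)\<^sup>2 * z powi n) abs_summable_on UNIV"
    and "(\<lambda>n. q powi (n * n) * z powi n) abs_summable_on UNIV"
proof -
  have z: "z = exp (ln z)" using assms by simp
  have "(qtri n)\<^sup>2 * z powi n = exp ((of_int n)\<^sup>2 * Q + of_int n * (ln z - Q))" for n
  proof -
    have "(qtri n)\<^sup>2 * z powi n
        = exp (of_int n * (of_int n - 1) / 2 * Q + of_int n * (of_int n - 1) / 2 * Q + of_int n * ln z)"
      by (subst z) (simp only: qtri_def exp_power_int exp_add power2_eq_square)
    also have "of_int n * (of_int n - 1) / 2 * Q + of_int n * (of_int n - 1) / 2 * Q + of_int n * ln z
        = (of_int n)\<^sup>2 * Q + of_int n * (ln z - Q)"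
      by (simp add: power2_eq_square field_simps)
    finally show ?thesis .
  qed
  thus "(\<lambda>n. (qtri n)\<^sup>2 * z powi n) abs_summable_on UNIV"
    using gauss_exp_abs_summable[OF Re_Q, of "ln z - Q"] by simp
  have "q powi (n * n) * z powi n = exp ((of_int n)\<^sup>2 * Q + of_int n * ln z)" for n
    by (subst z) (simp only: q_powi exp_power_int exp_add power2_eq_square of_int_mult)
  thus "(\<lambda>n. q powi (n * n) * z powi n) abs_summable_on UNIV"
    using gauss_exp_abs_summable[OF Re_Q, of "ln z"] by simp
qed

lemma square_theta_has_sum:
  assumes "z \<noteq> 0"
  shows "((\<lambda>n. (qtri n)\<^sup>2 * z powi n) has_sum (\<Sum>\<^sub>\<infinity>n. (qtri n)\<^sup>2 * z powi n)) UNIV"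
    and "((\<lambda>n. q powi (n * n) * z powi n) has_sum (\<Sum>\<^sub>\<infinity>n. q powi (n * n) * z powi n)) UNIV"
  by (rule has_sum_infsum[OF abs_summable_summable[OF square_theta_abs_summable(1)[OF assms]]],
      rule has_sum_infsum[OF abs_summable_summable[OF square_theta_abs_summable(2)[OF assms]]])

lemma minus_one_powi_twice: "(-1 :: complex) powi (n + n) = 1"
  by (simp add: power_int_add power_int_minus_one_mult_self)

text \<open>
  In the product of the two series, with indices \<open>i\<close> and \<open>j\<close>, the exponents of \<open>u\<close> and \<open>v\<close> are
  \<open>i + j\<close> and \<open>j - i\<close>.  They have the same parity, and in terms of them the quadratic exponent
  of \<open>q\<close> is diagonal.  The terms of even parity therefore form one product of two theta series and
  those of odd parity another, with the opposite sign.
\<close>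
lemma theta_product:
  assumes "u \<noteq> 0" "v \<noteq> 0" "c \<noteq> 0"
  shows "v * theta_series (- (u / v)) * theta_series (- (u * v / c))
       = theta_even c u * theta_odd c v - theta_even c v * theta_odd c u"
proof -
  define U V C where "U = ln u" and "V = ln v" and "C = ln c"
  have UVC: "u = exp U" "v = exp V" "c = exp C"
    using assms by (simp_all add: U_def V_def C_def)
  define t where "t i j = (qtri i * (- (u / v)) powi i) * (qtri j * (- (u * v / c)) powi j)" for i j
  have "((\<lambda>(i, j). t i j) has_sum (theta_series (- (u / v)) * theta_series (- (u * v / c)))) (UNIV \<times> UNIV)"
    unfolding t_def using assms
    by (intro has_sum_times theta_has_sum theta_abs_summable) auto
  hence S: "((\<lambda>(i, j). t i j) has_sum (theta_series (- (u / v)) * theta_series (- (u * v / c)))) UNIV"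
    by simp
  have t: "t i j = (-1) powi (i + j) * exp (of_int i * (of_int i - 1) / 2 * Q + of_int i * (U - V)
      + of_int j * (of_int j - 1) / 2 * Q + of_int j * (U + V - C))" for i j
  proof -
    have "(- (u / v)) powi i = (-1) powi i * exp (of_int i * (U - V))"
    proof -
      have "- (u / v) = (-1) * exp (U - V)" by (simp add: UVC exp_diff)
      thus ?thesis by (simp only: power_int_mult_distrib exp_power_int)
    qed
    moreover have "(- (u * v / c)) powi j = (-1) powi j * exp (of_int j * (U + V - C))"
    proof -
      have "- (u * v / c) = (-1) * exp (U + V - C)" by (simp add: UVC exp_diff exp_add)
      thus ?thesis by (simp only: power_int_mult_distrib exp_power_int)
    qed
    ultimately show ?thesis
      by (simp add: t_def qtri_def exp_add power_int_add)
  qed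
  have u2: "u\<^sup>2 / c = exp (2 * U - C)" and v2: "v\<^sup>2 / c = exp (2 * V - C)"
    by (simp_all add: UVC exp_diff exp_double)
  have nz: "u\<^sup>2 / c \<noteq> 0" "v\<^sup>2 / c \<noteq> 0" using assms by auto
  define s0 s1 where "s0 z = (\<Sum>\<^sub>\<infinity>n. (qtri n)\<^sup>2 * z powi n)"
    and "s1 z = (\<Sum>\<^sub>\<infinity>n. q powi (n * n) * z powi n)" for z
  \<comment> \<open>Even \<open>i + j\<close>: here \<open>i = n - m\<close> and \<open>j = n + m\<close>.\<close>
  have E: "((\<lambda>(i, j). t i j) has_sum (s0 (u\<^sup>2 / c) * s1 (v\<^sup>2 / c))) {(i, j). even (i + j)}"
  proof -
    have "((\<lambda>(n, m). ((qtri n)\<^sup>2 * (u\<^sup>2 / c) powi n) * (q powi (m * m) * (v\<^sup>2 / c) powi m))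
        has_sum (s0 (u\<^sup>2 / c) * s1 (v\<^sup>2 / c))) (UNIV \<times> UNIV)"
      unfolding s0_def s1_def
      by (intro has_sum_times square_theta_has_sum square_theta_abs_summable nz)
    also have "?this \<longleftrightarrow> ?thesis"
    proof (rule has_sum_reindex_bij_witness[of _ "\<lambda>(i, j). ((i + j) div 2, (j - i) div 2)" "\<lambda>(n, m). (n - m, n + m)"],
        goal_cases)
      case (5 p)
      obtain n m where p: "p = (n, m)" by force
      have "t (n - m) (n + m) = exp (of_int (n - m) * (of_int (n - m) - 1) / 2 * Q + of_int (n - m) * (U - V)
          + of_int (n + m) * (of_int (n + m) - 1) / 2 * Q + of_int (n + m) * (U + V - C))"
        using minus_one_powi_twice[of n] by (simp only: t) simp
      also have "of_int (n - m) * (of_int (n - m) - 1) / 2 * Q + of_int (n - m) * (U - V)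
          + of_int (n + m) * (of_int (n + m) - 1) / 2 * Q + of_int (n + m) * (U + V - C)
         = of_int n * (of_int n - 1) / 2 * Q + of_int n * (of_int n - 1) / 2 * Q + of_int n * (2 * U - C)
          + (of_int (m * m) * Q + of_int m * (2 * V - C))"
        by (simp add: field_simps)
      also have "exp \<dots> = ((qtri n)\<^sup>2 * (u\<^sup>2 / c) powi n) * (q powi (m * m) * (v\<^sup>2 / c) powi m)"
        unfolding u2 v2 by (simp only: qtri_def q_powi exp_power_int exp_add power2_eq_square)
      finally show ?case by (simp add: p)
    qed (auto, presburger+)
    finally show ?thesis .
  qed
  \<comment> \<open>Odd \<open>i + j\<close>: here \<open>i = n - m + 1\<close> and \<open>j = n + m\<close>, and the sign is negative.\<close>
  have O: "((\<lambda>(i, j). t i j) has_sum (- (u / v * s1 (u\<^sup>2 / c) * s0 (v\<^sup>2 / c)))) {(i, j). odd (i + j)}"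
  proof -
    have "((\<lambda>(n, m). (q powi (n * n) * (u\<^sup>2 / c) powi n) * ((qtri m)\<^sup>2 * (v\<^sup>2 / c) powi m))
        has_sum (s1 (u\<^sup>2 / c) * s0 (v\<^sup>2 / c))) (UNIV \<times> UNIV)"
      unfolding s0_def s1_def
      by (intro has_sum_times square_theta_has_sum square_theta_abs_summable nz)
    from has_sum_cmult_right[OF this, of "- (u / v)"]
    have "((\<lambda>(n, m). - (u / v) * ((q powi (n * n) * (u\<^sup>2 / c) powi n) * ((qtri m)\<^sup>2 * (v\<^sup>2 / c) powi m)))
        has_sum (- (u / v * s1 (u\<^sup>2 / c) * s0 (v\<^sup>2 / c)))) (UNIV \<times> UNIV)"
      by (simp add: case_prod_unfold mult_ac)
    also have "?this \<longleftrightarrow> ?thesis"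
    proof (rule has_sum_reindex_bij_witness[of _ "\<lambda>(i, j). ((i + j) div 2, (j - i + 1) div 2)"
          "\<lambda>(n, m). (n - m + 1, n + m)"], goal_cases)
      case (5 p)
      obtain n m where p: "p = (n, m)" by force
      have sgn: "(-1 :: complex) powi (n - m + 1 + (n + m)) = -1"
        using minus_one_powi_twice[of n] by (simp add: power_int_add add_ac)
      have "t (n - m + 1) (n + m) = - exp (of_int (n - m + 1) * (of_int (n - m + 1) - 1) / 2 * Q + of_int (n - m + 1) * (U - V)
          + of_int (n + m) * (of_int (n + m) - 1) / 2 * Q + of_int (n + m) * (U + V - C))"
        by (simp only: t sgn) simp
      also have "of_int (n - m + 1) * (of_int (n - m + 1) - 1) / 2 * Q + of_int (n - m + 1) * (U - V)
          + of_int (n + m) * (of_int (n + m) - 1) / 2 * Q + of_int (n + m) * (U + V - C)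
         = (U - V) + (of_int (n * n) * Q + of_int n * (2 * U - C)
          + (of_int m * (of_int m - 1) / 2 * Q + of_int m * (of_int m - 1) / 2 * Q + of_int m * (2 * V - C)))"
        by (simp add: field_simps)
      also have "exp \<dots> = (u / v) * ((q powi (n * n) * (u\<^sup>2 / c) powi n) * ((qtri m)\<^sup>2 * (v\<^sup>2 / c) powi m))"
        unfolding u2 v2 unfolding qtri_def q_powi exp_power_int power2_eq_square exp_add
        by (simp add: UVC exp_diff)
      finally show ?case by (simp add: p)
    qed (auto, presburger+)
    finally show ?thesis .
  qed
  have "{(i, j). even (i + j)} \<union> {(i, j). odd (i + j)} = (UNIV :: (int \<times> int) set)"
    by auto
  with has_sum_Un_disjoint[OF E O]
  have "((\<lambda>(i, j). t i j) has_sum (s0 (u\<^sup>2 / c) * s1 (v\<^sup>2 / c) + - (u / v * s1 (u\<^sup>2 / c) * s0 (v\<^sup>2 / c)))) UNIV"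
    by (auto simp: disjoint_iff)
  from has_sum_unique[OF S this] show ?thesis
    using assms(2) by (simp add: theta_even_def theta_odd_def s0_def[symmetric] s1_def[symmetric] field_simps)
qed

text \<open>
  This expands the vanishing determinant with rows \<open>(f, theta_even c, theta_odd c)\<close> at
  \<open>u\<close>, \<open>v\<close>, \<open>w\<close>; the minors are factored by \<open>theta_product\<close>.
\<close>
lemma theta_three_term:
  assumes "u \<noteq> 0" "v \<noteq> 0" "w \<noteq> 0" "c \<noteq> 0"
    and f: "\<And>z. z \<noteq> 0 \<Longrightarrow> f z = h0 * theta_even c z + h1 * theta_odd c z"
  shows "f u * (w * theta_series (- (v / w)) * theta_series (- (v * w / c)))
       = f v * (w * theta_series (- (u / w)) * theta_series (- (u * w / c)))
       - f w * (v * theta_series (- (u / v)) * theta_series (- (u * v / c)))"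
  unfolding theta_product[OF assms(2,3,4)] theta_product[OF assms(1,3,4)] theta_product[OF assms(1,2,4)]
  by (simp add: f assms(1-3) algebra_simps)

section \<open>The q-Laplace transform as a triple sum\<close>

text \<open>
  The function \<open>G(l, m)\<close> of the introduction.  Two independent variables are kept because the
  symmetry in them is what relates the transforms at \<open>x\<close> and at \<open>1/x\<close>.
\<close>
definition laplace_sum :: "complex \<Rightarrow> complex \<Rightarrow> complex \<Rightarrow> complex" where
  "laplace_sum a l m = (\<Sum>\<^sub>\<infinity>n. qpoch_inf q (- (m * q powi n)) * qpoch_inf q (- (q powi (1 - n) * a / m))
     * ((qtri n)\<^sup>2 * (l * m / a) powi n))"

text \<open>
  The general term after both products have been expanded by Euler's identity.  The index \<open>n\<close> is the
  summation index of the \<open>q\<close>-Laplace transform.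
\<close>
definition laplace_sum_term :: "complex \<Rightarrow> complex \<Rightarrow> complex \<Rightarrow> int \<times> nat \<times> nat \<Rightarrow> complex" where
  "laplace_sum_term a l m = (\<lambda>(n, i, j). (binom_coeff 0 (-1) i * (m * q powi n) ^ i)
     * (binom_coeff 0 (-1) j * (q powi (1 - n) * a / m) ^ j) * ((qtri n)\<^sup>2 * (l * m / a) powi n))"

definition laplace_sum_exponent :: "complex \<Rightarrow> complex \<Rightarrow> complex \<Rightarrow> int \<Rightarrow> nat \<Rightarrow> nat \<Rightarrow> complex" where
  "laplace_sum_exponent A L M n i j = of_nat i * (of_nat i - 1) / 2 * Q + of_nat i * (M + of_int n * Q)
     + of_nat j * (of_nat j - 1) / 2 * Q + of_nat j * (of_int (1 - n) * Q + A - M)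
     + of_int n * (of_int n - 1) * Q + of_int n * (L + M - A)"

lemma laplace_sum_term_exp:
  assumes "a = exp A" "l = exp L" "m = exp M"
  shows "laplace_sum_term a l m (n, i, j)
       = inverse (qpoch q q i) * inverse (qpoch q q j) * exp (laplace_sum_exponent A L M n i j)"
proof -
  have 1: "(m * q powi n) ^ i = exp (of_nat i * (M + of_int n * Q))"
    by (simp only: assms q_powi exp_add[symmetric] exp_of_nat_mult[symmetric])
  have 2: "(q powi (1 - n) * a / m) ^ j = exp (of_nat j * (of_int (1 - n) * Q + A - M))"
    by (simp only: assms q_powi exp_add[symmetric] exp_diff[symmetric] exp_of_nat_mult[symmetric])
  have 3: "(l * m / a) powi n = exp (of_int n * (L + M - A))"
    by (simp only: assms exp_add[symmetric] exp_diff[symmetric] exp_power_int)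
  have 4: "(qtri n)\<^sup>2 = exp (of_int n * (of_int n - 1) * Q)"
  proof -
    have "of_int n * (of_int n - 1) / 2 * Q + of_int n * (of_int n - 1) / 2 * Q = of_int n * (of_int n - 1) * Q"
      by simp
    thus ?thesis by (simp only: qtri_def power2_eq_square exp_add[symmetric])
  qed
  have 5: "qtri (int i) = exp (of_nat i * (of_nat i - 1) / 2 * Q)" for i
    by (simp add: qtri_def)
  show ?thesis
    unfolding laplace_sum_term_def prod.case 1 2 3 4 binom_coeff_0_m1 5 laplace_sum_exponent_def exp_add
    by (simp only: divide_inverse mult_ac)
qed

text \<open>
  The bound separates the three indices, so the triple sum is dominated by a product of three
  Gaussian sums.
\<close>
lemma Re_laplace_sum_exponent_le:
  fixes A L M :: complex
  defines "S \<equiv> 2 * \<bar>Re Q\<bar> + \<bar>Re A\<bar> + \<bar>Re L\<bar> + \<bar>Re M\<bar>"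
  shows "Re (laplace_sum_exponent A L M n i j)
    \<le> (S * \<bar>of_int n\<bar> - (- Re Q) / 8 * (of_int n)\<^sup>2)
      + ((S * real i - (- Re Q) / 8 * (real i)\<^sup>2) + (S * real j - (- Re Q) / 8 * (real j)\<^sup>2))"
proof -
  define r where "r = - Re Q"
  have r: "r > 0" using Re_Q by (simp add: r_def)
  define N where "N = real_of_int n"
  have "Re (laplace_sum_exponent A L M n i j)
      = - r * ((real i)\<^sup>2 / 2 + (real j)\<^sup>2 / 2 + real i * N - real j * N + N\<^sup>2)
        + real i * (r / 2 + Re M) + real j * (- r / 2 + Re A - Re M) + N * (r + Re L + Re M - Re A)"
    by (simp add: laplace_sum_exponent_def r_def N_def power2_eq_square field_simps)
  moreover have "real i * (r / 2 + Re M) \<le> real i * S"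
    by (intro mult_left_mono) (use r in \<open>auto simp: S_def r_def\<close>)
  moreover have "real j * (- r / 2 + Re A - Re M) \<le> real j * S"
    by (intro mult_left_mono) (use r in \<open>auto simp: S_def r_def\<close>)
  moreover have "N * (r + Re L + Re M - Re A) \<le> \<bar>N\<bar> * S"
  proof -
    have "N * (r + Re L + Re M - Re A) \<le> \<bar>N\<bar> * \<bar>r + Re L + Re M - Re A\<bar>"
      by (metis abs_ge_self abs_mult)
    also have "\<dots> \<le> \<bar>N\<bar> * S"
      by (intro mult_left_mono) (use r in \<open>auto simp: S_def r_def\<close>)
    finally show ?thesis .
  qed
  moreover have "- r * ((real i)\<^sup>2 / 2 + (real j)\<^sup>2 / 2 + real i * N - real j * N + N\<^sup>2)
      \<le> - r * (((real i)\<^sup>2 + (real j)\<^sup>2 + N\<^sup>2) / 8)"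
    using laplace_sum_quadratic_bound[of "real i" "real j" N] r by simp
  ultimately show ?thesis
    by (simp add: r_def N_def algebra_simps add_divide_distrib)
qed

lemma qpoch_q_inverse_bounded: "\<exists>K>0. \<forall>n. norm (inverse (qpoch q q n)) \<le> K"
proof -
  have "(\<lambda>n. inverse (qpoch q q n)) \<longlonglongrightarrow> inverse (qpoch_inf q q)"
    by (intro tendsto_inverse qpoch_tendsto qpoch_inf_nz norm_q)
  hence "Bseq (\<lambda>n. inverse (qpoch q q n))"
    by (rule convergent_imp_Bseq[OF convergentI])
  thus ?thesis unfolding Bseq_def .
qed

lemma laplace_sum_term_abs_summable:
  assumes "a \<noteq> 0" "l \<noteq> 0" "m \<noteq> 0"
  shows "laplace_sum_term a l m abs_summable_on UNIV"
proof -
  obtain K where K: "K > 0" "\<And>n. norm (inverse (qpoch q q n)) \<le> K"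
    using qpoch_q_inverse_bounded by blast
  define A L M where "A = ln a" and "L = ln l" and "M = ln m"
  have ALM: "a = exp A" "l = exp L" "m = exp M"
    using assms by (simp_all add: A_def L_def M_def)
  \<comment> \<open>Any bound for all linear coefficients of the exponent will do.\<close>
  define S where "S = 2 * \<bar>Re Q\<bar> + \<bar>Re A\<bar> + \<bar>Re L\<bar> + \<bar>Re M\<bar>"
  define r where "r = - Re Q / 8"
  have r: "r > 0" using Re_Q by (simp add: r_def)
  define h where "h = (\<lambda>n::int. exp (complex_of_real (S * \<bar>real_of_int n\<bar> - r * (real_of_int n)\<^sup>2)))"
  define g where "g = (\<lambda>n::nat. exp (complex_of_real (S * real n - r * (real n)\<^sup>2)))"
  have h: "h abs_summable_on UNIV"
    using gauss_summable[OF r, of S] by (simp add: h_def)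
  have g: "g abs_summable_on UNIV"
    using gauss_summable_nat[OF r, of S] norm_summable_imp_summable_on[of "\<lambda>n. norm (g n)"]
    by (simp add: g_def)
  have "(\<lambda>(n, p). h n * (\<lambda>(i, j). g i * g j) p) abs_summable_on (UNIV \<times> (UNIV \<times> UNIV))"
    by (intro abs_summable_on_times h g)
  hence B: "(\<lambda>(n, i, j). h n * (g i * g j)) abs_summable_on UNIV"
    by (simp add: case_prod_unfold)
  have "(\<lambda>x. (K * K) * norm ((\<lambda>(n, i, j). h n * (g i * g j)) x)) summable_on UNIV"
    by (rule summable_on_cmult_right[OF B])
  thus ?thesis
  proof (rule Infinite_Sum.abs_summable_on_comparison_test')
    fix p :: "int \<times> nat \<times> nat"
    obtain n i j where p: "p = (n, i, j)" using prod_cases3 by blast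
    have "norm (laplace_sum_term a l m p) = norm (inverse (qpoch q q i)) * norm (inverse (qpoch q q j))
        * exp (Re (laplace_sum_exponent A L M n i j))"
      by (simp add: p laplace_sum_term_exp[OF ALM] norm_mult)
    also have "\<dots> \<le> K * K * exp ((S * \<bar>of_int n\<bar> - r * (of_int n)\<^sup>2)
      + ((S * real i - r * (real i)\<^sup>2) + (S * real j - r * (real j)\<^sup>2)))"
      using Re_laplace_sum_exponent_le[of A L M n i j] K
      by (intro mult_mono) (auto simp: S_def r_def)
    also have "\<dots> = K * K * norm ((\<lambda>(n, i, j). h n * (g i * g j)) p)"
      by (simp add: p h_def g_def norm_mult exp_add)
    finally show "norm (laplace_sum_term a l m p) \<le> K * K * norm ((\<lambda>(n, i, j). h n * (g i * g j)) p)" .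
  qed
qed

lemma
  assumes "a \<noteq> 0" "l \<noteq> 0" "m \<noteq> 0"
  shows laplace_sum_has_sum: "(laplace_sum_term a l m has_sum laplace_sum a l m) (UNIV \<times> UNIV)"
    and laplace_sum_outer_has_sum: "((\<lambda>n. qpoch_inf q (- (m * q powi n)) * qpoch_inf q (- (q powi (1 - n) * a / m))
       * ((qtri n)\<^sup>2 * (l * m / a) powi n)) has_sum laplace_sum a l m) UNIV"
proof -
  obtain S where S: "(laplace_sum_term a l m has_sum S) (UNIV \<times> UNIV)"
    using abs_summable_summable[OF laplace_sum_term_abs_summable[OF assms]] by (auto simp: summable_on_def)
  have inner: "((\<lambda>p. laplace_sum_term a l m (n, p)) has_sum
      (qpoch_inf q (- (m * q powi n)) * qpoch_inf q (- (q powi (1 - n) * a / m))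
       * ((qtri n)\<^sup>2 * (l * m / a) powi n))) UNIV" for n
  proof -
    have "((\<lambda>(i, j). (binom_coeff 0 (-1) i * (m * q powi n) ^ i)
        * (binom_coeff 0 (-1) j * (q powi (1 - n) * a / m) ^ j)) has_sum
        (qpoch_inf q (- (m * q powi n)) * qpoch_inf q (- (q powi (1 - n) * a / m)))) (UNIV \<times> UNIV)"
      by (intro has_sum_times euler_has_sum euler_abs_summable)
    from has_sum_cmult_left[OF this, of "(qtri n)\<^sup>2 * (l * m / a) powi n"]
    show ?thesis by (simp add: laplace_sum_term_def case_prod_unfold)
  qed
  have outer: "((\<lambda>n. qpoch_inf q (- (m * q powi n)) * qpoch_inf q (- (q powi (1 - n) * a / m))
       * ((qtri n)\<^sup>2 * (l * m / a) powi n)) has_sum S) UNIV"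
    by (rule has_sum_SigmaD[OF S inner])
  have eq: "S = laplace_sum a l m"
    unfolding laplace_sum_def by (rule infsumI[OF outer, symmetric])
  show "(laplace_sum_term a l m has_sum laplace_sum a l m) (UNIV \<times> UNIV)"
    using S unfolding eq .
  show "((\<lambda>n. qpoch_inf q (- (m * q powi n)) * qpoch_inf q (- (q powi (1 - n) * a / m))
       * ((qtri n)\<^sup>2 * (l * m / a) powi n)) has_sum laplace_sum a l m) UNIV"
    using outer unfolding eq .
qed

text \<open>
  The exponent is invariant under exchanging \<open>l\<close> with \<open>m\<close> and \<open>i\<close> with \<open>j\<close> while replacing
  \<open>n\<close> by \<open>n + i - j\<close>, an involution on the index set.
\<close>
lemma laplace_sum_commute:
  assumes "a \<noteq> 0" "l \<noteq> 0" "m \<noteq> 0"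
  shows "laplace_sum a l m = laplace_sum a m l"
proof -
  define A L M where "A = ln a" and "L = ln l" and "M = ln m"
  have ALM: "a = exp A" "l = exp L" "m = exp M"
    using assms by (simp_all add: A_def L_def M_def)
  have "(laplace_sum_term a l m has_sum laplace_sum a m l) (UNIV \<times> UNIV) \<longleftrightarrow>
        (laplace_sum_term a m l has_sum laplace_sum a m l) (UNIV \<times> UNIV)"
  proof (rule has_sum_reindex_bij_witness[of _ "\<lambda>(n, i, j). (n + int i - int j, j, i)"
        "\<lambda>(n, i, j). (n + int i - int j, j, i)"], goal_cases)
    case (5 p)
    obtain n i j where p: "p = (n, i, j)" using prod_cases3 by blast
    have "laplace_sum_exponent A M L (n + int i - int j) j i = laplace_sum_exponent A L M n i j"
      by (simp add: laplace_sum_exponent_def field_simps)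
    thus ?case
      by (simp add: p laplace_sum_term_exp[OF ALM] laplace_sum_term_exp[OF ALM(1,3,2)])
  qed auto
  with laplace_sum_has_sum[OF assms(1,3,2)] laplace_sum_has_sum[OF assms] show ?thesis
    using has_sum_unique by blast
qed

text \<open>
  For fixed \<open>i\<close>, \<open>j\<close> the sum over \<open>n\<close> is a theta series in \<open>u^2\<close> whose argument is shifted by
  \<open>q^(i - j)\<close>.  An even shift \<open>i - j = 2 k\<close> is undone by \<open>n \<mapsto> n - k\<close> and gives a multiple of the
  even basis function; after an odd shift the odd one remains.
\<close>
lemma laplace_sum_theta_expansion:
  assumes "a \<noteq> 0" "x \<noteq> 0"
  obtains h0 h1 where "\<And>u. u \<noteq> 0 \<Longrightarrow> laplace_sum a (u / x) u = h0 * theta_even (a * x) u + h1 * theta_odd (a * x) u"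
proof -
  define A X where "A = ln a" and "X = ln x"
  have AX: "a = exp A" "x = exp X"
    using assms by (simp_all add: A_def X_def)
  define c where "c = a * x"
  have c: "c = exp (A + X)" by (simp add: c_def AX exp_add)
  define e where "e i j = inverse (qpoch q q i) * inverse (qpoch q q j)
    * exp (of_nat i * (of_nat i - 1) / 2 * Q + of_nat j * (of_nat j - 1) / 2 * Q + of_nat j * (Q + A))" for i j
  define s where "s i j = (int i - int j) div 2" for i j :: nat
  \<comment> \<open>The contributions of \<open>i\<close>, \<open>j\<close> to the two coefficients; the powers of \<open>c\<close> and \<open>q\<close> arise from the shift by \<open>s i j\<close>.\<close>
  define \<alpha> where "\<alpha> = (\<lambda>(i, j). e i j * (c powi s i j * q powi (s i j - s i j * s i j)))"
  define \<beta> where "\<beta> = (\<lambda>(i, j). e i j * (c powi s i j * q powi (- (s i j * s i j))))"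
  define Ev Od where "Ev = {(i, j :: nat). even (i + j)}" and "Od = {(i :: nat, j). odd (i + j)}"
  define h0 h1 where "h0 = infsum \<alpha> Ev" and "h1 = infsum \<beta> Od"
  show ?thesis
  proof (rule that[of h0 h1])
    fix u :: complex assume u: "u \<noteq> 0"
    define U where "U = ln u"
    have U: "u = exp U" using u by (simp add: U_def)
    have ux: "u / x = exp (U - X)" by (simp add: U AX exp_diff)
    have nz: "u\<^sup>2 / c \<noteq> 0" using u by (simp add: c)
    have u2: "u\<^sup>2 / c = exp (2 * U - A - X)"
      by (simp add: c U exp_diff exp_add exp_double)
    define F where "F p = (if p \<in> Ev then \<alpha> p * theta_even c u else \<beta> p * theta_odd c u)" for p
    have "((\<lambda>(p, n). laplace_sum_term a (u / x) u (n, p)) has_sum laplace_sum a (u / x) u) (UNIV \<times> UNIV)"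
    proof -
      have "u / x \<noteq> 0" using assms u by simp
      from laplace_sum_has_sum[OF assms(1) this u] show ?thesis by (rule iffD1[OF has_sum_swap])
    qed
    moreover have "((\<lambda>n. case (p, n) of (p, n) \<Rightarrow> laplace_sum_term a (u / x) u (n, p)) has_sum F p) UNIV" for p
    proof -
      obtain i j where p: "p = (i, j)" by force
      show ?thesis
      proof (cases "even (i + j)")
        case True
        hence "even (int i - int j)" by simp
        then obtain k where k: "int i - int j = 2 * k" by (elim evenE)
        hence s: "s i j = k" by (simp add: s_def)
        have ck: "c powi k = exp (of_int k * (A + X))"
          by (simp only: c exp_power_int)
        have ij: "of_nat i = (of_nat j + 2 * of_int k :: complex)"
          using k by (metis add_diff_cancel_left' diff_add_cancel of_int_add of_int_mult of_int_numeral of_int_of_nat_eq add.commute)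
        have "((\<lambda>n. \<alpha> p * ((qtri n)\<^sup>2 * (u\<^sup>2 / c) powi n)) has_sum (\<alpha> p * theta_even c u)) UNIV"
          unfolding theta_even_def by (intro has_sum_cmult_right square_theta_has_sum nz)
        also have "?this \<longleftrightarrow> ((\<lambda>n. laplace_sum_term a (u / x) u (n, p)) has_sum (\<alpha> p * theta_even c u)) UNIV"
        proof (rule has_sum_reindex_bij_witness[of _ "\<lambda>n. n + k" "\<lambda>n. n - k"], goal_cases)
          case (5 n)
          have "laplace_sum_exponent A (U - X) U (n - k) i j
            = of_nat i * (of_nat i - 1) / 2 * Q + of_nat j * (of_nat j - 1) / 2 * Q + of_nat j * (Q + A)
              + (of_int k * (A + X) + of_int (k - k * k) * Q
              + (of_int n * (of_int n - 1) / 2 * Q + of_int n * (of_int n - 1) / 2 * Q + of_int n * (2 * U - A - X)))"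
            unfolding ij laplace_sum_exponent_def by (simp add: field_simps)
          hence "laplace_sum_term a (u / x) u (n - k, p) = \<alpha> p * ((qtri n)\<^sup>2 * (u\<^sup>2 / c) powi n)"
            unfolding p laplace_sum_term_exp[OF AX(1) ux U] \<alpha>_def u2
            by (simp only: s ck e_def qtri_def power2_eq_square q_powi exp_power_int exp_add prod.case mult.assoc)
          thus ?case .
        qed auto
        finally show ?thesis using True by (simp add: F_def Ev_def p)
      next
        case False
        hence "odd (int i - int j)" by simp
        then obtain k where k: "int i - int j = 2 * k + 1" by (elim oddE)
        hence s: "s i j = k" by (simp add: s_def)
        have ck: "c powi k = exp (of_int k * (A + X))"
          by (simp only: c exp_power_int)
        have ij: "of_nat i = (of_nat j + 2 * of_int k + 1 :: complex)"
        proof -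
          have "int i = int j + 2 * k + 1" using k by simp
          hence "of_int (int i) = (of_int (int j + 2 * k + 1) :: complex)" by simp
          thus ?thesis by simp
        qed
        have "((\<lambda>n. \<beta> p * (u * (q powi (n * n) * (u\<^sup>2 / c) powi n))) has_sum (\<beta> p * theta_odd c u)) UNIV"
          unfolding theta_odd_def by (intro has_sum_cmult_right square_theta_has_sum nz)
        also have "?this \<longleftrightarrow> ((\<lambda>n. laplace_sum_term a (u / x) u (n, p)) has_sum (\<beta> p * theta_odd c u)) UNIV"
        proof (rule has_sum_reindex_bij_witness[of _ "\<lambda>n. n + k" "\<lambda>n. n - k"], goal_cases)
          case (5 n)
          have "laplace_sum_exponent A (U - X) U (n - k) i j
            = of_nat i * (of_nat i - 1) / 2 * Q + of_nat j * (of_nat j - 1) / 2 * Q + of_nat j * (Q + A)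
              + (of_int k * (A + X) + of_int (- (k * k)) * Q
              + (U + (of_int (n * n) * Q + of_int n * (2 * U - A - X))))"
            unfolding ij laplace_sum_exponent_def by (simp add: field_simps)
          hence "laplace_sum_term a (u / x) u (n - k, p) = \<beta> p * (u * (q powi (n * n) * (u\<^sup>2 / c) powi n))"
            unfolding p laplace_sum_term_exp[OF AX(1) ux U] \<beta>_def u2
            by (simp only: s ck e_def q_powi exp_power_int exp_add prod.case mult.assoc U)
          thus ?case .
        qed auto
        finally show ?thesis using False by (simp add: F_def Ev_def p)
      qed
    qed
    ultimately have F: "(F has_sum laplace_sum a (u / x) u) UNIV"
      by (rule has_sum_SigmaD)
    hence S: "F summable_on UNIV" by (rule has_sum_imp_summable)
    have un: "UNIV = Ev \<union> Od" and disj: "Ev \<inter> Od = {}"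
      by (auto simp: Ev_def Od_def)
    have "laplace_sum a (u / x) u = infsum F (Ev \<union> Od)"
      using infsumI[OF F] un by simp
    also have "\<dots> = infsum F Ev + infsum F Od"
      by (intro infsum_Un_disjoint summable_on_subset[OF S] disj) auto
    also have "infsum F Ev = infsum (\<lambda>p. \<alpha> p * theta_even c u) Ev"
      by (rule infsum_cong) (simp add: F_def)
    also have "\<dots> = h0 * theta_even c u"
      unfolding h0_def by (rule infsum_cmult_left')
    also have "infsum F Od = infsum (\<lambda>p. \<beta> p * theta_odd c u) Od"
      by (rule infsum_cong) (use disj in \<open>auto simp: F_def\<close>)
    also have "\<dots> = h1 * theta_odd c u"
      unfolding h1_def by (rule infsum_cmult_left')
    finally show "laplace_sum a (u / x) u = h0 * theta_even (a * x) u + h1 * theta_odd (a * x) u"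
      by (simp add: c_def)
  qed
qed

section \<open>The q-Borel and q-Laplace transforms\<close>

text \<open>
  Euler's expansion is a power series with infinite radius of convergence.
\<close>
lemma qpoch_inf_holomorphic: "qpoch_inf q holomorphic_on UNIV"
proof -
  have S: "summable (\<lambda>n. binom_coeff 0 1 n * z ^ n)" for z
    by (rule summable_norm_cancel[OF norm_summable_binom_coeff]) simp
  have "fps_conv_radius (Abs_fps (binom_coeff 0 1)) = \<infinity>"
    unfolding fps_conv_radius_def by (rule conv_radius_inftyI'') (simp add: S)
  hence "eval_fps (Abs_fps (binom_coeff 0 1)) holomorphic_on UNIV"
    by (intro holomorphic_on_eval_fps) simp
  moreover have "eval_fps (Abs_fps (binom_coeff 0 1)) = qpoch_inf q"
    using q_binomial_suminf[of 0 _ 1] by (auto simp: eval_fps_def)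
  ultimately show ?thesis by simp
qed

lemma qpoch_inf_analytic: "(\<lambda>z. qpoch_inf q (c * z)) analytic_on A"
proof -
  have "qpoch_inf q \<circ> (\<lambda>z. c * z) holomorphic_on UNIV"
    by (intro holomorphic_on_compose_gen[OF _ qpoch_inf_holomorphic] holomorphic_intros) auto
  hence "(\<lambda>z. qpoch_inf q (c * z)) analytic_on UNIV"
    by (simp add: analytic_on_open o_def)
  thus ?thesis by (rule analytic_on_subset) auto
qed

text \<open>
  Near the origin the transformed series is summed by the \<open>q\<close>-binomial theorem.  The quotient of
  entire functions, with its singularities removed, is the nicely meromorphic continuation; at a point
  where the denominator does not vanish it is the quotient itself.
\<close>
lemma qBorel_f0_tilde:
  assumes "a \<noteq> 0" "qpoch_inf q (- (\<xi> / a)) \<noteq> 0"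
  shows "qBorel q (f0_tilde q a) \<xi> = qpoch_inf q (- \<xi>) / qpoch_inf q (- (\<xi> / a))"
proof -
  define g where "g = (\<lambda>z. qpoch_inf q (- z) / qpoch_inf q (- (z / a)))"
  define F where "F = Abs_fps (\<lambda>n. fps_nth (f0_tilde q a) n * q ^ (n * (n - 1) div 2))"
  have an: "(\<lambda>z. qpoch_inf q (- z)) analytic_on A" "(\<lambda>z. qpoch_inf q (- (z / a))) analytic_on A" for A
    using qpoch_inf_analytic[of "-1" A] qpoch_inf_analytic[of "- 1 / a" A] by simp_all
  have g_an: "g analytic_on {z}" if "qpoch_inf q (- (z / a)) \<noteq> 0" for z
    unfolding g_def using that by (intro analytic_on_divide an) auto
  have "g meromorphic_on UNIV"
    unfolding g_def by (intro meromorphic_on_divide analytic_on_imp_meromorphic_on an)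
  hence nice: "remove_sings g nicely_meromorphic_on UNIV"
    by (rule remove_sings_nicely_meromorphic)
  have near0: "remove_sings g z = eval_fps F z" if z: "norm z < norm a" for z
  proof -
    have "norm (1 * (- (z / a))) < 1" using z assms(1) by (simp add: norm_divide)
    note * = q_binomial_suminf[OF this, of a]
    have nz: "qpoch_inf q (- (z / a)) \<noteq> 0"
      by (rule qpoch_inf_nz) (use z assms(1) in \<open>simp add: norm_divide\<close>)
    have "fps_nth F n * z ^ n = binom_coeff 1 a n * (- (z / a)) ^ n" for n
    proof -
      have "(- (z / a)) ^ n = (-1) ^ n * (1 / a) ^ n * z ^ n"
        by (simp flip: power_mult_distrib)
      thus ?thesis by (simp add: F_def fps_nth_f0_tilde binom_coeff_def qpoch_def)
    qed
    hence "eval_fps F z = (\<Sum>n. binom_coeff 1 a n * (- (z / a)) ^ n)"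
      by (simp add: eval_fps_def)
    also have "\<dots> = g z"
      using * nz assms(1) by (simp add: g_def field_simps)
    also have "\<dots> = remove_sings g z"
      by (rule remove_sings_at_analytic[OF g_an[OF nz], symmetric])
    finally show ?thesis ..
  qed
  have "eventually (\<lambda>z. z \<in> ball 0 (norm a)) (nhds (0 :: complex))"
    using assms(1) by (intro eventually_nhds_in_open) auto
  hence ev: "eventually (\<lambda>z. remove_sings g z = eval_fps F z) (nhds 0)"
    by eventually_elim (simp add: near0)
  have "qBorel q (f0_tilde q a) = remove_sings g"
    unfolding qBorel_def F_def[symmetric]
  proof (rule the_equality)
    show "remove_sings g nicely_meromorphic_on UNIV \<and> (\<forall>\<^sub>F \<xi> in nhds 0. remove_sings g \<xi> = eval_fps F \<xi>)"
      using nice ev by blast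
    fix h assume h: "h nicely_meromorphic_on UNIV \<and> (\<forall>\<^sub>F \<xi> in nhds 0. h \<xi> = eval_fps F \<xi>)"
    hence "\<forall>\<^sub>F \<xi> in nhds 0. h \<xi> = eval_fps F \<xi>" by blast
    with ev have "\<forall>\<^sub>F \<xi> in nhds 0. h \<xi> = remove_sings g \<xi>"
      by eventually_elim simp
    thus "h = remove_sings g"
      using h nice nicely_meromorphic_eqI by blast
  qed
  thus ?thesis
    using remove_sings_at_analytic[OF g_an[OF assms(2)]] by (simp add: g_def)
qed

text \<open>
  The factor \<open>1 / (-\<lambda> q^n/a)\<^sub>\<infinity>\<close> of each term is the complementary product
  \<open>(-q^(1-n) a/\<lambda>)\<^sub>\<infinity>\<close> divided by \<open>\<theta>(\<lambda> q^n/a)\<close>, up to a constant, and both theta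
  denominators depend on \<open>n\<close> only through a monomial.  If \<open>\<theta>(\<lambda>/x) = 0\<close>, both sides are zero by
  the convention for division.
\<close>
lemma qLaplace_eq_laplace_sum:
  assumes "a \<noteq> 0" "x \<noteq> 0" "lam \<noteq> 0" "qtheta q (lam / a) \<noteq> 0"
  shows "qLaplace q (qBorel q (f0_tilde q a)) x lam
       = qpoch_inf q q * laplace_sum a (lam / x) lam / (qtheta q (lam / a) * qtheta q (lam / x))"
proof -
  have "qBorel q (f0_tilde q a) (lam * q powi n) / qtheta q (lam * q powi n / x)
    = qpoch_inf q q / (qtheta q (lam / a) * qtheta q (lam / x))
      * (qpoch_inf q (- (lam * q powi n)) * qpoch_inf q (- (q powi (1 - n) * a / lam))
        * ((qtri n)\<^sup>2 * (lam / x * lam / a) powi n))" for n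
  proof -
    define w where "w = lam / a"
    have w: "w \<noteq> 0" using assms by (simp add: w_def)
    have th: "qtri n * w powi n * qtheta q (q powi n * w) = qtheta q (lam / a)"
      using qtheta_powi_shift[OF w] by (simp add: w_def)
    hence nz: "qtheta q (q powi n * w) \<noteq> 0"
      using assms(4) by auto
    have e1: "- (q powi n * w) = - (lam * q powi n / a)"
      by (simp add: w_def)
    have e2: "- q / (q powi n * w) = - (q powi (1 - n) * a / lam)"
      using assms(1,3) by (simp add: w_def power_int_diff field_simps)
    have prod: "qtheta q (q powi n * w)
        = qpoch_inf q q * qpoch_inf q (- (lam * q powi n / a)) * qpoch_inf q (- (q powi (1 - n) * a / lam))"
      by (simp only: qtheta_def e1 e2)
    hence nz': "qpoch_inf q (- (lam * q powi n / a)) \<noteq> 0"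
      using nz by auto
    have B: "qBorel q (f0_tilde q a) (lam * q powi n)
        = qpoch_inf q (- (lam * q powi n)) / qpoch_inf q (- (lam * q powi n / a))"
      by (rule qBorel_f0_tilde[OF assms(1) nz'])
    have D: "1 / qpoch_inf q (- (lam * q powi n / a))
        = qpoch_inf q q * qpoch_inf q (- (q powi (1 - n) * a / lam)) * (qtri n * w powi n) / qtheta q (lam / a)"
      using nz' assms(4) unfolding th[symmetric] prod by (simp add: field_simps)
    have "lam / x \<noteq> 0" using assms by simp
    from qtheta_powi_shift[OF this, of n]
    have th': "qtri n * (lam / x) powi n * qtheta q (lam * q powi n / x) = qtheta q (lam / x)"
      by (simp add: mult_ac)
    have T: "1 / qtheta q (lam * q powi n / x) = qtri n * (lam / x) powi n / qtheta q (lam / x)"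
      using assms(2,3) unfolding th'[symmetric] by simp
    have P: "(lam / x * lam / a) powi n = w powi n * (lam / x) powi n"
      by (simp add: w_def mult_ac flip: power_int_mult_distrib)
    have "qBorel q (f0_tilde q a) (lam * q powi n) / qtheta q (lam * q powi n / x)
      = qpoch_inf q (- (lam * q powi n)) * (1 / qpoch_inf q (- (lam * q powi n / a)))
        * (1 / qtheta q (lam * q powi n / x))"
      unfolding B by simp
    also have "\<dots> = qpoch_inf q q / (qtheta q (lam / a) * qtheta q (lam / x))
      * (qpoch_inf q (- (lam * q powi n)) * qpoch_inf q (- (q powi (1 - n) * a / lam))
        * ((qtri n)\<^sup>2 * (lam / x * lam / a) powi n))"
      unfolding D T P by (simp add: power2_eq_square)
    finally show ?thesis .
  qed
  hence "qLaplace q (qBorel q (f0_tilde q a)) x lam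
      = qpoch_inf q q / (qtheta q (lam / a) * qtheta q (lam / x)) * laplace_sum a (lam / x) lam"
    unfolding qLaplace_def laplace_sum_def infsum_cmult_right'[symmetric] by simp
  thus ?thesis by simp
qed

lemma qtri_of_nat: "qtri (int n) = q ^ (n * (n - 1) div 2)"
proof (induction n)
  case (Suc n)
  have "Suc n * (Suc n - 1) div 2 = n * (n - 1) div 2 + n"
    by (cases n) auto
  thus ?case by (simp only: qtri_Suc Suc.IH power_add)
qed simp

text \<open>
  Reversing the order of the factors: \<open>1 - a q^(-j) = -a q^(-j) (1 - q^j/a)\<close>.
\<close>
lemma qpoch_backwards:
  assumes "a \<noteq> 0"
  shows "qpoch q (a * q powi (- int n)) n * qtri (int (Suc n)) = (- a) ^ n * qpoch q (q / a) n"
proof (induction n)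
  case (Suc n)
  define y where "y = a * q powi (- int (Suc n))"
  have y: "y = a / q ^ Suc n"
    unfolding y_def power_int_minus power_int_of_nat by (rule divide_inverse[symmetric])
  have yq: "y * q = a * q powi (- int n)"
    by (simp add: y power_int_minus field_simps)
  have "qpoch q y (1 + n) = (1 - y) * qpoch q (y * q) n"
    unfolding qpoch_add by (simp add: qpoch_def)
  hence "qpoch q y (Suc n) * qtri (int (Suc (Suc n)))
      = (1 - y) * q ^ Suc n * (qpoch q (a * q powi (- int n)) n * qtri (int (Suc n)))"
    unfolding qtri_Suc[of "Suc n"] yq by simp
  also have "\<dots> = (1 - y) * q ^ Suc n * ((- a) ^ n * qpoch q (q / a) n)"
    unfolding Suc.IH ..
  also have "(1 - y) * q ^ Suc n = - a * (1 - q / a * q ^ n)"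
    using assms by (simp add: y field_simps)
  also have "- a * (1 - q / a * q ^ n) * ((- a) ^ n * qpoch q (q / a) n) = (- a) ^ Suc n * qpoch q (q / a) (Suc n)"
    by (simp add: qpoch_def)
  finally show ?case by (simp add: y_def)
qed (simp add: qpoch_def)

text \<open>
  At \<open>m = -1\<close> the factor \<open>(q^n)\<^sub>\<infinity>\<close> kills every term with \<open>n \<le> 0\<close>.  With \<open>n = k + 1\<close>,
  reversing the finite part of \<open>(q^(-k) a)\<^sub>\<infinity>\<close> produces the numerators \<open>(q/a)\<^sub>k\<close>.
\<close>
lemma laplace_sum_at_minus_one:
  assumes "a \<noteq> 0" "x \<noteq> 0"
  shows "laplace_sum a (- (1 / x)) (- 1) * (a * x)
       = qpoch_inf q q * qpoch_inf q a * eval_fps (qhyp q [q / a] [0]) (1 / x * q)"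
proof -
  define t where "t n = qpoch_inf q (q powi n) * qpoch_inf q (q powi (1 - n) * a)
     * ((qtri n)\<^sup>2 * (1 / (a * x)) powi n)" for n
  define s where "s n = qpoch q (q / a) n / qpoch q q n * (-1) ^ n * q ^ (n * (n - 1) div 2) * (1 / x * q) ^ n" for n
  have "(t has_sum laplace_sum a (- (1 / x)) (- 1)) UNIV"
    using laplace_sum_outer_has_sum[of a "- (1 / x)" "-1"] assms by (simp add: t_def[abs_def] mult_ac)
  also have "?this \<longleftrightarrow> (t has_sum laplace_sum a (- (1 / x)) (- 1)) {1..}"
  proof (rule has_sum_cong_neutral)
    fix n :: int assume "n \<in> UNIV - {1..}"
    thus "t n = 0" using qpoch_inf_q_neg[of "nat (- n)"] by (simp add: t_def)
  qed auto
  also have "\<dots> \<longleftrightarrow> ((\<lambda>n. t (int (Suc n))) has_sum laplace_sum a (- (1 / x)) (- 1)) UNIV"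
    by (rule has_sum_reindex_bij_witness[of _ "\<lambda>n. int (Suc n)" "\<lambda>n. nat (n - 1)"]) auto
  finally have "((\<lambda>n. t (int (Suc n)) * (a * x)) has_sum (laplace_sum a (- (1 / x)) (- 1) * (a * x))) UNIV"
    by (rule has_sum_cmult_left)
  moreover have "t (int (Suc n)) * (a * x) = qpoch_inf q q * qpoch_inf q a * s n" for n
  proof -
    have "qpoch_inf q (q powi (1 - int (Suc n)) * a) = qpoch q (a * q powi (- int n)) n * qpoch_inf q a"
      using qpoch_inf_split[of "a * q powi (- int n)" n] by (simp add: power_int_minus mult_ac)
    hence "t (int (Suc n)) * (a * x) = qpoch_inf q q / qpoch q q n * qpoch_inf q a
        * (qpoch q (a * q powi (- int n)) n * qtri (int (Suc n))) * qtri (int (Suc n)) * (1 / (a * x)) ^ n"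
      using qpoch_inf_q_Suc[of n] assms
      by (simp add: t_def power2_eq_square power_int_add del: of_nat_Suc)
    also have "\<dots> = qpoch_inf q q / qpoch q q n * qpoch_inf q a * ((- a) ^ n * qpoch q (q / a) n)
        * (q ^ (n * (n - 1) div 2) * q ^ n) * (1 / (a * x)) ^ n"
      unfolding qpoch_backwards[OF assms(1)] by (simp only: qtri_Suc) (simp only: qtri_of_nat)
    also have "(- a) ^ n = (-1) ^ n * a ^ n"
      by (rule power_minus)
    finally show ?thesis
      using assms by (simp add: s_def power_mult_distrib power_divide)
  qed
  ultimately have "((\<lambda>n. qpoch_inf q q * qpoch_inf q a * s n) has_sum (laplace_sum a (- (1 / x)) (- 1) * (a * x))) UNIV"
    by simp
  hence sums: "(\<lambda>n. qpoch_inf q q * qpoch_inf q a * s n) sums (laplace_sum a (- (1 / x)) (- 1) * (a * x))"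
    by (rule has_sum_imp_sums)
  show ?thesis
  proof (cases "qpoch_inf q q * qpoch_inf q a = 0")
    case True
    have "laplace_sum a (- (1 / x)) (- 1) * (a * x) = 0"
      using sums_unique[OF sums] unfolding True by simp
    thus ?thesis unfolding True by simp
  next
    case False
    hence "s sums (laplace_sum a (- (1 / x)) (- 1) * (a * x) / (qpoch_inf q q * qpoch_inf q a))"
      using sums_divide[OF sums, of "qpoch_inf q q * qpoch_inf q a"] by simp
    thus ?thesis
      using False by (simp add: eval_qhyp_1_1 s_def[abs_def] sums_iff)
  qed
qed

lemma qtheta_inverse: "z \<noteq> 0 \<Longrightarrow> z * qtheta q (1 / z) = qtheta q z"
proof -
  assume z: "z \<noteq> 0"
  have 1: "qpoch_inf q (- z) = (1 + z) * qpoch_inf q (- (q * z))"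
    using qpoch_inf_rec[of "- z"] by (simp add: mult.commute)
  have 2: "z * qpoch_inf q (- (1 / z)) = (1 + z) * qpoch_inf q (- q / z)"
    using qpoch_inf_rec[of "- 1 / z"] z by (simp add: field_simps)
  have "z * qtheta q (1 / z) = qpoch_inf q q * qpoch_inf q (- (q * z)) * (z * qpoch_inf q (- (1 / z)))"
    by (simp add: qtheta_def)
  also have "\<dots> = qtheta q z"
    unfolding 2 by (simp add: qtheta_def 1)
  finally show ?thesis .
qed

section \<open>The connection formula\<close>

text \<open>
  The connection formula cleared of denominators.  The points \<open>-1\<close> and \<open>x \<lambda>\<close> are chosen so that the
  order-two theta function takes the values needed there, and the minors of the three-term relation
  are then exactly the theta factors of the formula.
\<close>
lemma laplace_sum_connection:
  assumes "a \<noteq> 0" "x \<noteq> 0" "lam \<noteq> 0" "lam' \<noteq> 0"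
  shows "laplace_sum a (lam' / x) lam' * (qtheta q (x * lam) * qtheta q (lam / a))
    = qpoch_inf q q * qpoch_inf q a * eval_fps (qhyp q [q / a] [0]) (1 / x * q) * (lam / a)
        * (qtheta q (- (lam' / (x * lam))) * qtheta q (- (lam * lam' / a)))
      + laplace_sum a (lam * x) lam * (qtheta q lam' * qtheta q (lam' / (a * x)))"
proof -
  define w where "w = x * lam"
  have nz: "w \<noteq> 0" "a * x \<noteq> 0" "(-1 :: complex) \<noteq> 0" using assms by (simp_all add: w_def)
  obtain h0 h1 where h: "\<And>u. u \<noteq> 0 \<Longrightarrow> laplace_sum a (u / x) u = h0 * theta_even (a * x) u + h1 * theta_odd (a * x) u"
    using laplace_sum_theta_expansion[OF assms(1,2)] by blast
  from theta_three_term[where f = "\<lambda>u. laplace_sum a (u / x) u", OF assms(4) nz(3,1,2) h]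
  have main: "laplace_sum a (lam' / x) lam' * (w * theta_series (- (- 1 / w)) * theta_series (- (- 1 * w / (a * x))))
       = laplace_sum a (- 1 / x) (- 1) * (w * theta_series (- (lam' / w)) * theta_series (- (lam' * w / (a * x))))
       - laplace_sum a (w / x) w * (- 1 * theta_series (- (lam' / - 1)) * theta_series (- (lam' * - 1 / (a * x))))"
    by blast
  have jt: "theta_series z = qtheta q z" if "z \<noteq> 0" for z
    using jacobi_triple_product[OF that] by simp
  have 1: "w * theta_series (- (- 1 / w)) = qtheta q (x * lam)"
    using qtheta_inverse[OF nz(1)] jt[of "1 / w"] nz by (simp add: w_def)
  have 2: "theta_series (- (- 1 * w / (a * x))) = qtheta q (lam / a)"
    using jt[of "lam / a"] assms by (simp add: w_def)
  have 3: "theta_series (- (lam' / w)) = qtheta q (- (lam' / (x * lam)))"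
    using assms by (subst jt) (auto simp: w_def)
  have 4: "theta_series (- (lam' * w / (a * x))) = qtheta q (- (lam * lam' / a))"
    using jt[of "- (lam * lam' / a)"] assms by (simp add: w_def mult_ac)
  have 5: "theta_series (- (lam' / - 1)) = qtheta q lam'"
    using jt[of lam'] assms by simp
  have 6: "theta_series (- (lam' * - 1 / (a * x))) = qtheta q (lam' / (a * x))"
    using jt[of "lam' / (a * x)"] assms by simp
  \<comment> \<open>Here the symmetry enters: \<open>G(\<lambda>, x \<lambda>) = G(x \<lambda>, \<lambda>)\<close>.\<close>
  have 7: "laplace_sum a (w / x) w = laplace_sum a (lam * x) lam"
    using laplace_sum_commute[of a lam "x * lam"] assms by (simp add: w_def mult_ac)
  have 8: "laplace_sum a (- 1 / x) (- 1) * w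
      = qpoch_inf q q * qpoch_inf q a * eval_fps (qhyp q [q / a] [0]) (1 / x * q) * (lam / a)"
    using laplace_sum_at_minus_one[OF assms(1,2)] assms by (simp add: w_def field_simps)
  have "laplace_sum a (lam' / x) lam' * (qtheta q (x * lam) * qtheta q (lam / a))
      = (laplace_sum a (- 1 / x) (- 1) * w) * (qtheta q (- (lam' / (x * lam))) * qtheta q (- (lam * lam' / a)))
      + laplace_sum a (w / x) w * (qtheta q lam' * qtheta q (lam' / (a * x)))"
    using main unfolding 1 2 3 4 5 6 by (simp add: algebra_simps)
  thus ?thesis by (simp only: 7 8)
qed

end

text \<open>
  What remains is bookkeeping: reflecting theta arguments by \<open>z \<theta>(1/z) = \<theta>(z)\<close> and
  cancelling.  The sign in front of \<open>g\<^sub>\<infinity>\<close> comes from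
  \<open>\<theta>(-x) = -x \<theta>(-1/x)\<close>, which turns its denominator into that of the formula.
\<close>
theorem theorem2p3:
  fixes \<tau> \<alpha> q a l x lam lam' :: complex
  assumes "Im \<tau> > 0"
    and "q = qpower \<tau> 1"
    and "a = qpower \<tau> \<alpha>"
    and "x = exp l"
    and "x \<noteq> 0" and "lam \<noteq> 0" and "lam' \<noteq> 0"
    and "qtheta q (lam' / a) \<noteq> 0"
    and "qtheta q (x / lam') \<noteq> 0"
    and "qtheta q (x * lam) \<noteq> 0"
    and "qtheta q (lam' / x) \<noteq> 0"
    and "qtheta q (a / lam) \<noteq> 0"
    and "qtheta q (- (1 / x)) \<noteq> 0"
  shows "f_0 \<tau> \<alpha> l lam' =
      qtheta q lam' * qtheta q (a * x / lam') * exp (\<alpha> * l)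
        / (qtheta q (lam' / a) * qtheta q (x / lam') * a)
        * f_infinity \<tau> \<alpha> l lam
    - qpoch_inf q a * (qpoch_inf q q)\<^sup>2
        * (qtheta q (- (lam' / (x * lam))) * qtheta q (- x) * qtheta q (- (lam * lam' / a))
           / (qtheta q (x * lam) * qtheta q (lam' / x) * qtheta q (lam' / a) * qtheta q (a / lam)))
        * g_infinity \<tau> \<alpha> l"
proof -
  define Q where "Q = 2 * of_real pi * \<i> * \<tau>"
  interpret nome Q q
    by standard (use assms(1,2) in \<open>simp_all add: Q_def qpower_def\<close>)
  have a: "a \<noteq> 0" by (simp add: assms(3) qpower_def)
  note x = \<open>x \<noteq> 0\<close> and lam = \<open>lam \<noteq> 0\<close> and lam' = \<open>lam' \<noteq> 0\<close>
  define e where "e = exp (\<alpha> / 2 * l)"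
  have e: "e \<noteq> 0" "exp (\<alpha> * l) = e\<^sup>2" "exp (\<alpha> / 2 * - l) = 1 / e" "exp ((1 - \<alpha> / 2) * - l) = e / x"
  proof -
    show "exp (\<alpha> * l) = e\<^sup>2"
      by (simp add: e_def flip: exp_double)
    have "(1 - \<alpha> / 2) * - l = \<alpha> / 2 * l - l" by (simp add: algebra_simps)
    thus "exp ((1 - \<alpha> / 2) * - l) = e / x"
      by (simp only: e_def assms(4) exp_diff)
  qed (simp_all add: e_def exp_minus inverse_eq_divide)
  define \<Phi> where "\<Phi> = eval_fps (qhyp q [q / a] [0]) (1 / x * q)"
  have alam: "qtheta q (a / lam) = a / lam * qtheta q (lam / a)"
    using qtheta_inverse[of "a / lam"] a lam by simp
  hence lama: "qtheta q (lam / a) \<noteq> 0"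
    using assms(12) by auto
  have xl: "qtheta q (x / lam') = x / lam' * qtheta q (lam' / x)"
    using qtheta_inverse[of "x / lam'"] x lam' by simp
  have axl: "qtheta q (a * x / lam') = a * x / lam' * qtheta q (lam' / (a * x))"
    using qtheta_inverse[of "a * x / lam'"] a x lam' by simp
  have f0: "f_0 \<tau> \<alpha> l lam' = e * (qpoch_inf q q * laplace_sum a (lam' / x) lam' / (qtheta q (lam' / a) * qtheta q (lam' / x)))"
    using qLaplace_eq_laplace_sum[OF a x lam' assms(8)]
    by (simp add: f_0_def Let_def e_def flip: assms(2,3,4))
  have finf: "f_infinity \<tau> \<alpha> l lam = 1 / e * (qpoch_inf q q * laplace_sum a (lam * x) lam / (qtheta q (lam / a) * qtheta q (x * lam)))"
    using qLaplace_eq_laplace_sum[OF a _ lam lama, of "1 / x"] x e(3)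
    by (simp add: f_infinity_def f_0_def Let_def exp_minus inverse_eq_divide mult.commute flip: assms(2,3,4))
  have ginf: "qtheta q (- x) * g_infinity \<tau> \<alpha> l = - (e * \<Phi>)"
  proof -
    have "g_infinity \<tau> \<alpha> l = e / x / qtheta q (- (1 / x)) * \<Phi>"
      using e(4) by (simp add: g_infinity_def g_0_def Let_def exp_minus inverse_eq_divide \<Phi>_def flip: assms(2,3,4))
    moreover have "qtheta q (- x) = - x * qtheta q (- (1 / x))"
      using qtheta_inverse[of "- x"] x by simp
    ultimately show ?thesis using x assms(13) by simp
  qed
  define R where "R = qtheta q (- (lam' / (x * lam))) * qtheta q (- (lam * lam' / a))"
  define D where "D = qtheta q (lam' / a) * qtheta q (lam' / x) * (qtheta q (x * lam) * qtheta q (lam / a))"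
  have D: "D \<noteq> 0" using assms(8,10,11) lama by (simp add: D_def)
  have T1: "qtheta q lam' * qtheta q (a * x / lam') * exp (\<alpha> * l)
        / (qtheta q (lam' / a) * qtheta q (x / lam') * a) * f_infinity \<tau> \<alpha> l lam
      = e * qpoch_inf q q * (laplace_sum a (lam * x) lam * (qtheta q lam' * qtheta q (lam' / (a * x)))) / D"
    unfolding finf xl axl e(2) D_def using a x lam' e(1) assms(8,10,11) lama
    by (simp add: power2_eq_square mult_ac)
  have T2: "qpoch_inf q a * (qpoch_inf q q)\<^sup>2
        * (qtheta q (- (lam' / (x * lam))) * qtheta q (- x) * qtheta q (- (lam * lam' / a))
           / (qtheta q (x * lam) * qtheta q (lam' / x) * qtheta q (lam' / a) * qtheta q (a / lam)))
        * g_infinity \<tau> \<alpha> l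
      = - (e * qpoch_inf q q * (qpoch_inf q q * qpoch_inf q a * \<Phi> * (lam / a) * R) / D)"
  proof -
    have "qpoch_inf q a * (qpoch_inf q q)\<^sup>2
        * (qtheta q (- (lam' / (x * lam))) * qtheta q (- x) * qtheta q (- (lam * lam' / a))
           / (qtheta q (x * lam) * qtheta q (lam' / x) * qtheta q (lam' / a) * qtheta q (a / lam)))
        * g_infinity \<tau> \<alpha> l
      = qpoch_inf q a * (qpoch_inf q q)\<^sup>2 * R * (qtheta q (- x) * g_infinity \<tau> \<alpha> l) / (D * (a / lam))"
      unfolding alam R_def D_def by (simp add: mult_ac)
    also have "\<dots> = - (e * qpoch_inf q q * (qpoch_inf q q * qpoch_inf q a * \<Phi> * (lam / a) * R) / D)"
      unfolding ginf using a lam D by (simp add: power2_eq_square mult_ac)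
    finally show ?thesis .
  qed
  have "f_0 \<tau> \<alpha> l lam' = e * qpoch_inf q q * (laplace_sum a (lam' / x) lam' * (qtheta q (x * lam) * qtheta q (lam / a))) / D"
    unfolding f0 D_def using assms(8,10,11) lama by simp
  also have "\<dots> = e * qpoch_inf q q * (qpoch_inf q q * qpoch_inf q a * \<Phi> * (lam / a) * R) / D
      + e * qpoch_inf q q * (laplace_sum a (lam * x) lam * (qtheta q lam' * qtheta q (lam' / (a * x)))) / D"
    unfolding laplace_sum_connection[OF a x lam lam'] \<Phi>_def R_def by (simp add: algebra_simps add_divide_distrib)
  finally show ?thesis
    unfolding T1 T2 by simp
qed

end
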